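(* Assume $\|X\|/p\le\lambda\le 2\bar\lambda$ with $\bar\lambda=2\|X\|\sqrt{\log p}$, and that there are constants $A_1,A_2,A_3,A_4>0$ (not depending on $p$) such that $A_1p^{-A_3}\pi_p(s-1)\le\pi_p(s)\le A_2p^{-A_4}\pi_p(s-1)$ for $s=1,\dots,p$. Then for any $M>2$, \[ \sup_{\beta^0,\beta^*\in\mathbb R^p}\mathbb E_{\beta^0}\Pi\Big(\beta:|S_\beta|>|S_*|+\frac M{A_4}\Big(1+\frac{16}{\phi(S_* )^2}\frac\lambda{\bar\lambda}\Big)|S_*|+\frac M{A_4}\frac{\|X(\beta^0-\beta^* )\|_2^2}{\log p}\ \Big|\ Y\Big)\to0 \] as $n,p\to\infty$, where $S_*=S_{\beta^*}$.
   Context: Observations follow $Y=X\beta+\varepsilon$ with $X$ a deterministic real $n\times p$ matrix and $\varepsilon\sim N_n(0,I_n)$; $\mathbb E_{\beta^0}$ is expectation when $Y\sim N_n(X\beta^0,I_n)$. $S_\beta=\{i:\beta_i\ne0\}$, $\beta_S=(\beta_i)_{i\in S}$, $\|X\|=\max_i\|X_{\cdot,i}\|_2$. Prior $\Pi$: draw $s\sim\pi_p$ on $\{0,\dots,p\}$, then $S$ uniform among subsets of size $s$, then $\beta_i$, $i\in S$, i.i.d. with density $\frac\lambda2e^{-\lambda|x|}$, $\beta_i=0$ for $i\notin S$. Posterior $\Pi(B\mid Y)=\int_Be^{-\|Y-X\beta\|_2^2/2}d\Pi(\beta)/\int e^{-\|Y-X\beta\|_2^2/2}d\Pi(\beta)$.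 $\phi(S)=\inf\{\|X\beta\|_2|S|^{1/2}/(\|X\|\|\beta_S\|_1):\|\beta_{S^c}\|_1\le7\|\beta_S\|_1,\beta_S\ne0\}$. Asymptotics: $n,p\to\infty$ with $X,\lambda,\pi_p$ depending on $n,p$ subject to the assumptions (constants $A_i$ fixed). *)

theory Defs
  imports "HOL-Probability.Probability"
begin

text \<open>Vectors in R^p are represented as functions nat => real; only the
  coordinates i < p matter. The design matrix X (n x p) is a function
  nat => nat => real, X j i = entry in row j < n, column i < p.\<close>

definition Xmul :: "nat \<Rightarrow> (nat \<Rightarrow> nat \<Rightarrow> real) \<Rightarrow> (nat \<Rightarrow> real) \<Rightarrow> nat \<Rightarrow> real" where
  "Xmul p X \<beta> = (\<lambda>j. \<Sum>i<p. X j i * \<beta> i)"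

definition l2norm :: "nat \<Rightarrow> (nat \<Rightarrow> real) \<Rightarrow> real" where
  "l2norm n v = sqrt (\<Sum>j<n. (v j)\<^sup>2)"

definition colnorm :: "nat \<Rightarrow> nat \<Rightarrow> (nat \<Rightarrow> nat \<Rightarrow> real) \<Rightarrow> real" where
  "colnorm n p X = Max ((\<lambda>i. sqrt (\<Sum>j<n. (X j i)\<^sup>2)) ` {..<p})"

definition lambar :: "nat \<Rightarrow> nat \<Rightarrow> (nat \<Rightarrow> nat \<Rightarrow> real) \<Rightarrow> real" where
  "lambar n p X = 2 * colnorm n p X * sqrt (ln (real p))"

definition supp :: "nat \<Rightarrow> (nat \<Rightarrow> real) \<Rightarrow> nat set" where
  "supp p \<beta> = {i. i < p \<and> \<beta> i \<noteq> 0}"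

definition l1on :: "nat set \<Rightarrow> (nat \<Rightarrow> real) \<Rightarrow> real" where
  "l1on S \<beta> = (\<Sum>i\<in>S. \<bar>\<beta> i\<bar>)"

definition compat :: "nat \<Rightarrow> nat \<Rightarrow> (nat \<Rightarrow> nat \<Rightarrow> real) \<Rightarrow> nat set \<Rightarrow> real" where
  "compat n p X S = Inf {l2norm n (Xmul p X \<beta>) * sqrt (real (card S)) / (colnorm n p X * l1on S \<beta>) | \<beta>.
      l1on ({..<p} - S) \<beta> \<le> 7 * l1on S \<beta> \<and> (\<exists>i\<in>S. \<beta> i \<noteq> 0)}"

definition laplace_measure :: "real \<Rightarrow> real measure" where
  "laplace_measure lam = density lborel (\<lambda>x. ennreal (lam / 2 * exp (- lam * \<bar>x\<bar>)))"

definition zero_ext :: "nat set \<Rightarrow> (nat \<Rightarrow> real) \<Rightarrow> nat \<Rightarrow> real" where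
  "zero_ext S x = (\<lambda>i. if i \<in> S then x i else 0)"

text \<open>Integral of a nonnegative function against the prior Pi on R^p:
  s ~ pi_p, S uniform of size s, beta_S iid Laplace(lam), beta_{S^c} = 0.\<close>
definition prior_nn :: "nat \<Rightarrow> real \<Rightarrow> (nat \<Rightarrow> real) \<Rightarrow> ((nat \<Rightarrow> real) \<Rightarrow> ennreal) \<Rightarrow> ennreal" where
  "prior_nn p lam pis f =
     (\<Sum>s\<le>p. ennreal (pis s / real (p choose s)) *
        (\<Sum>S\<in>{S. S \<subseteq> {..<p} \<and> card S = s}.
           \<integral>\<^sup>+ x. f (zero_ext S x) \<partial>(PiM S (\<lambda>_. laplace_measure lam))))"

definition lik :: "nat \<Rightarrow> nat \<Rightarrow> (nat \<Rightarrow> nat \<Rightarrow> real) \<Rightarrow> (nat \<Rightarrow> real) \<Rightarrow> (nat \<Rightarrow> real) \<Rightarrow> real" where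
  "lik n p X Y \<beta> = exp (- (\<Sum>j<n. (Y j - Xmul p X \<beta> j)\<^sup>2) / 2)"

definition posterior :: "nat \<Rightarrow> nat \<Rightarrow> (nat \<Rightarrow> nat \<Rightarrow> real) \<Rightarrow> real \<Rightarrow> (nat \<Rightarrow> real)
    \<Rightarrow> (nat \<Rightarrow> real) set \<Rightarrow> (nat \<Rightarrow> real) \<Rightarrow> ennreal" where
  "posterior n p X lam pis B Y =
     prior_nn p lam pis (\<lambda>\<beta>. indicator B \<beta> * ennreal (lik n p X Y \<beta>)) /
     prior_nn p lam pis (\<lambda>\<beta>. ennreal (lik n p X Y \<beta>))"

definition data_measure :: "nat \<Rightarrow> nat \<Rightarrow> (nat \<Rightarrow> nat \<Rightarrow> real) \<Rightarrow> (nat \<Rightarrow> real) \<Rightarrow> (nat \<Rightarrow> real) measure" where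
  "data_measure n p X \<beta>0 = PiM {..<n} (\<lambda>j. density lborel (normal_density (Xmul p X \<beta>0 j) 1))"

text \<open>The event of the theorem. When phi(S_*) = 0 and S_* nonempty the threshold
  is +infinity, so the event is empty (guard below).\<close>
definition event :: "nat \<Rightarrow> nat \<Rightarrow> (nat \<Rightarrow> nat \<Rightarrow> real) \<Rightarrow> real \<Rightarrow> real \<Rightarrow> real
    \<Rightarrow> (nat \<Rightarrow> real) \<Rightarrow> (nat \<Rightarrow> real) \<Rightarrow> (nat \<Rightarrow> real) set" where
  "event n p X lam A4 M \<beta>0 \<beta>s =
     {\<beta>. (supp p \<beta>s = {} \<or> compat n p X (supp p \<beta>s) > 0) \<and>
          real (card (supp p \<beta>)) >
            real (card (supp p \<beta>s))
            + M / A4 * (1 + 16 / (compat n p X (supp p \<beta>s))\<^sup>2 * (lam / lambar n p X)) * real (card (supp p \<beta>s))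
            + M / A4 * (l2norm n (\<lambda>j. Xmul p X \<beta>0 j - Xmul p X \<beta>s j))\<^sup>2 / ln (real p)}"

end

(* Write d = b - b_star, delta = X (b_0 - b_star), D = |delta|^2, and let L be the density of the data
   law under b_0 relative to the one under b_star. The evidence is at least exp(-2 s_star - 1/2) times
   pi_p(s_star) p^(-2 s_star) exp(-lam |b_star|_1) times the likelihood of b_star. On the event that
   all columns of X have inner product at most lambar with the noise, the fraction
   lam / (2 lambar) of the noise term of the log likelihood ratio is at most lam |d|_1 / 2, and the
   remaining noise term is integrated against the Gaussian law; the fraction left over
   of -|X d|^2 / 2 then beats lam |d_S|_1 through the compatibility number. Hence the mass of
   the models of size s is at most L times a variable whose mean is controlled by pi_p(s) 4^s,
   and the prior ratio makes the sum over s > s_star + J of size about p^(-A4 J), where J is the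
   excess in the theorem.
   As the posterior mass is at most 1, passing from b_0 to b_star costs only a
   Cauchy-Schwarz factor exp(D), which M > 2 absorbs. *)
theory Submission
  imports Defs "HOL-Real_Asymp.Real_Asymp"
begin

section \<open>Laplace and Gaussian integrals\<close>

text \<open>The obstacle is a \<open>lam\<close> far below \<open>lambar\<close>: the penalty then
  cannot absorb the whole noise term. The fraction r = \<open>lam / (2 * lambar)\<close> is the
  largest that fits under \<open>lam\<close> |d|_1 / 2, and \<open>lam \<le> 2 * lambar\<close> says
  that r \<le> 1. The quadratic gain that survives is also only r |X d|^2 / 4, which is how the
  ratio \<open>lam / lambar\<close> gets into the threshold.

  The lower limit on \<open>lam\<close> serves the evidence. Of its factor p^(-2 s_star), one half
  is the prior mass of a small box around b_star inside the true model, the other half is the price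
  of drawing that model among all models of its size.

  The value 2 below \<open>M\<close> is needed twice. The excess must beat this p^(2 s_star), and it
  must beat exp (2 D): the likelihood ratio L and the variable that multiplies it each carry a
  factor exp D in the bounds on their means. The same slack M - 2 has to pay for all constants and
  still leave a negative power of p.\<close>

lemma nn_integral_exp_abs_le:
  fixes c m :: real
  assumes "c > 0"
  shows "(\<integral>\<^sup>+x. ennreal (exp (- c * \<bar>x - m\<bar>)) \<partial>lborel) \<le> ennreal (2 / c)"
proof -
  have e1: "(\<integral>\<^sup>+x. ennreal (erlang_density 0 c x) \<partial>lborel) = 1"
    using nn_integral_erlang_ith_moment[OF assms, of 0 0] by simp
  have e2: "(\<integral>\<^sup>+x. ennreal (erlang_density 0 c (- x)) \<partial>lborel) = 1"
    using nn_integral_real_affine[of "\<lambda>x. ennreal (erlang_density 0 c x)" "-1" 0] e1 by simp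
  have "(\<integral>\<^sup>+x. ennreal (exp (- c * \<bar>x - m\<bar>)) \<partial>lborel) = (\<integral>\<^sup>+x. ennreal (exp (- c * \<bar>x\<bar>)) \<partial>lborel)"
    using nn_integral_real_affine[of "\<lambda>x. ennreal (exp (- c * \<bar>x - m\<bar>))" 1 m] by simp
  \<comment> \<open>Order 0 of the Erlang family is the exponential density. Its two reflected
    copies overlap only at 0, so their sum dominates the kernel everywhere.\<close>
  also have "\<dots> \<le> (\<integral>\<^sup>+x. ennreal (1 / c) * (ennreal (erlang_density 0 c x) + ennreal (erlang_density 0 c (- x))) \<partial>lborel)"
    using assms
    by (intro nn_integral_mono)
      (auto simp: erlang_density_def ennreal_mult[symmetric] ennreal_plus[symmetric] abs_if
        simp del: ennreal_plus intro!: ennreal_leI)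
  also have "\<dots> = ennreal (1 / c) * (1 + 1)"
    by (simp add: nn_integral_cmult nn_integral_add e1 e2)
  also have "\<dots> = ennreal (1 / c) * ennreal 2" by simp
  also have "\<dots> = ennreal (2 / c)"
    using assms ennreal_mult[of "1 / c" 2] by simp
  finally show ?thesis .
qed

lemma sets_laplace_measure [measurable_cong, simp]: "sets (laplace_measure lam) = sets borel"
  by (simp add: laplace_measure_def)

lemma space_laplace_measure [simp]: "space (laplace_measure lam) = UNIV"
  by (simp add: laplace_measure_def)

lemma nn_integral_laplace:
  assumes [measurable]: "f \<in> borel_measurable borel"
  shows "(\<integral>\<^sup>+x. f x \<partial>laplace_measure lam) = (\<integral>\<^sup>+x. ennreal (lam / 2 * exp (- lam * \<bar>x\<bar>)) * f x \<partial>lborel)"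
  unfolding laplace_measure_def by (subst nn_integral_density) auto

text \<open>The factor \<open>exp (lam * \<bar>x\<bar>)\<close> cancels the decay of the prior
  density, which leaves \<open>lam / 2\<close> times a kernel of rate \<open>lam / 4\<close>. The
  bound is free of \<open>lam\<close> and \<open>m\<close>; it is the base of the factor
  \<open>4 ^ s\<close> paid by models of size s.\<close>

lemma nn_integral_laplace_tilt_le:
  assumes "lam > 0"
  shows "(\<integral>\<^sup>+x. ennreal (exp (lam * \<bar>x\<bar> - lam / 4 * \<bar>x - m\<bar>)) \<partial>laplace_measure lam) \<le> 4"
proof -
  have "(\<integral>\<^sup>+x. ennreal (exp (lam * \<bar>x\<bar> - lam / 4 * \<bar>x - m\<bar>)) \<partial>laplace_measure lam)
     = (\<integral>\<^sup>+x. ennreal (lam / 2) * ennreal (exp (- (lam / 4) * \<bar>x - m\<bar>)) \<partial>lborel)"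
    using assms
    by (subst nn_integral_laplace)
       (auto intro!: nn_integral_cong simp: ennreal_mult[symmetric] exp_add[symmetric])
  also have "\<dots> \<le> ennreal (lam / 2) * ennreal (2 / (lam / 4))"
    using assms by (subst nn_integral_cmult) (use nn_integral_exp_abs_le[of "lam / 4" m] in \<open>auto intro!: mult_left_mono\<close>)
  also have "\<dots> = 4"
    using assms by (simp add: ennreal_mult[symmetric])
  finally show ?thesis .
qed

lemma finite_measure_laplace:
  assumes "lam > 0" shows "finite_measure (laplace_measure lam)"
proof
  have "emeasure (laplace_measure lam) (space (laplace_measure lam)) = (\<integral>\<^sup>+x. 1 \<partial>laplace_measure lam)"
    by simp
  also have "\<dots> \<le> (\<integral>\<^sup>+x. ennreal (exp (lam * \<bar>x\<bar> - lam / 4 * \<bar>x - 0\<bar>)) \<partial>laplace_measure lam)"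
    using assms by (intro nn_integral_mono) (auto simp: zero_le_mult_iff simp flip: ennreal_1 intro!: ennreal_leI)
  also have "\<dots> \<le> 4" by (rule nn_integral_laplace_tilt_le[OF assms])
  finally show "emeasure (laplace_measure lam) (space (laplace_measure lam)) \<noteq> \<infinity>"
    by (auto simp: top_unique)
qed

text \<open>By the triangle inequality the density at \<open>x - a\<close> is at most
  \<open>exp (lam * \<bar>a\<bar>)\<close> times the density at \<open>x\<close>. This is the price
  of recentring the prior.\<close>

lemma nn_integral_laplace_shift_le:
  assumes "lam > 0" and [measurable]: "f \<in> borel_measurable borel"
  shows "(\<integral>\<^sup>+x. f (x + a) \<partial>laplace_measure lam) \<le> ennreal (exp (lam * \<bar>a\<bar>)) * (\<integral>\<^sup>+x. f x \<partial>laplace_measure lam)"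
proof -
  have "(\<integral>\<^sup>+x. f (x + a) \<partial>laplace_measure lam)
      = (\<integral>\<^sup>+x. ennreal (lam / 2 * exp (- lam * \<bar>x - a\<bar>)) * f x \<partial>lborel)"
    using nn_integral_real_affine[of "\<lambda>x. ennreal (lam / 2 * exp (- lam * \<bar>x - a\<bar>)) * f x" 1 a]
    by (simp add: nn_integral_laplace add.commute)
  also have "\<dots> \<le> (\<integral>\<^sup>+x. ennreal (exp (lam * \<bar>a\<bar>)) * (ennreal (lam / 2 * exp (- lam * \<bar>x\<bar>)) * f x) \<partial>lborel)"
  proof (rule nn_integral_mono)
    fix x :: real
    have "lam * \<bar>x\<bar> \<le> lam * (\<bar>x - a\<bar> + \<bar>a\<bar>)"
      using assms by (intro mult_left_mono) auto
    then have "lam / 2 * exp (- lam * \<bar>x - a\<bar>) \<le> exp (lam * \<bar>a\<bar>) * (lam / 2 * exp (- lam * \<bar>x\<bar>))"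
      using assms by (simp add: exp_add[symmetric] algebra_simps)
    then show "ennreal (lam / 2 * exp (- lam * \<bar>x - a\<bar>)) * f x
       \<le> ennreal (exp (lam * \<bar>a\<bar>)) * (ennreal (lam / 2 * exp (- lam * \<bar>x\<bar>)) * f x)"
      using assms unfolding mult.assoc[symmetric]
      by (intro mult_right_mono) (auto simp: ennreal_mult[symmetric] intro!: ennreal_leI)
  qed
  also have "\<dots> = ennreal (exp (lam * \<bar>a\<bar>)) * (\<integral>\<^sup>+x. f x \<partial>laplace_measure lam)"
    by (subst nn_integral_cmult) (auto simp: nn_integral_laplace)
  finally show ?thesis .
qed

lemma nn_integral_laplace_uminus:
  assumes [measurable]: "f \<in> borel_measurable borel"
  shows "(\<integral>\<^sup>+x. f (- x) \<partial>laplace_measure lam) = (\<integral>\<^sup>+x. f x \<partial>laplace_measure lam)"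
  using nn_integral_real_affine[of "\<lambda>x. ennreal (lam / 2 * exp (- lam * \<bar>x\<bar>)) * f x" "-1" 0]
  by (simp add: nn_integral_laplace)

lemma emeasure_laplace_interval_ge:
  assumes "lam > 0" "\<rho> \<ge> 0" "lam * \<rho> \<le> 1"
  shows "emeasure (laplace_measure lam) {-\<rho>..\<rho>} \<ge> ennreal (lam * \<rho> * exp (- 1))"
proof -
  have "ennreal (lam * \<rho> * exp (- 1)) = (\<integral>\<^sup>+x. ennreal (lam / 2 * exp (- 1)) * indicator {-\<rho>..\<rho>} x \<partial>lborel)"
    using assms by (subst nn_integral_cmult_indicator) (auto simp: ennreal_mult[symmetric])
  also have "\<dots> \<le> (\<integral>\<^sup>+x. ennreal (lam / 2 * exp (- lam * \<bar>x\<bar>)) * indicator {-\<rho>..\<rho>} x \<partial>lborel)"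
  proof (intro nn_integral_mono)
    fix x :: real
    show "ennreal (lam / 2 * exp (- 1)) * indicator {-\<rho>..\<rho>} x
        \<le> ennreal (lam / 2 * exp (- lam * \<bar>x\<bar>)) * indicator {-\<rho>..\<rho>} x"
    proof (cases "x \<in> {-\<rho>..\<rho>}")
      case True
      then have "lam * \<bar>x\<bar> \<le> lam * \<rho>" using assms by (intro mult_left_mono) auto
      then have "lam * \<bar>x\<bar> \<le> 1" using assms by linarith
      then show ?thesis using True assms by (auto intro!: ennreal_leI)
    qed simp
  qed
  also have "\<dots> = emeasure (laplace_measure lam) {-\<rho>..\<rho>}"
    unfolding laplace_measure_def by (subst emeasure_density) auto
  finally show ?thesis .
qed

lemma product_sigma_finite_laplace: "lam > 0 \<Longrightarrow> product_sigma_finite (\<lambda>_. laplace_measure lam)"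
  unfolding product_sigma_finite_def
  using finite_measure_laplace finite_measure_def by blast

text \<open>Tensorisation: a one-dimensional change of variables with loss \<open>c i\<close> can be
  made one coordinate at a time by Fubini, so the losses multiply. The map \<open>T\<close> is kept
  general because both a shift and a reflection of the Laplace product are needed.\<close>

lemma nn_integral_PiM_map_le:
  fixes N :: "real measure" and T :: "'i \<Rightarrow> real \<Rightarrow> real"
  assumes "finite S" and N: "product_sigma_finite (\<lambda>_::'i. N)"
    and [measurable_cong]: "sets N = sets borel"
    and T: "\<And>i. i \<in> S \<Longrightarrow> T i \<in> borel_measurable borel"
    and le: "\<And>i f. i \<in> S \<Longrightarrow> f \<in> borel_measurable borel \<Longrightarrow>
       (\<integral>\<^sup>+x. f (T i x) \<partial>N) \<le> c i * (\<integral>\<^sup>+x. f x \<partial>N)"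
    and "f \<in> borel_measurable (PiM S (\<lambda>_. N))"
  shows "(\<integral>\<^sup>+x. f (\<lambda>i\<in>S. T i (x i)) \<partial>PiM S (\<lambda>_. N)) \<le> (\<Prod>i\<in>S. c i) * (\<integral>\<^sup>+x. f x \<partial>PiM S (\<lambda>_. N))"
  using assms(1,4-6)
proof (induction S arbitrary: f)
  case empty
  interpret product_sigma_finite "\<lambda>_::'i. N" by (rule N)
  show ?case
    by (simp only: nn_integral_empty zero_le prod.empty mult_1_left) (simp add: restrict_def)
next
  case (insert i S)
  interpret product_sigma_finite "\<lambda>_::'i. N" by (rule N)
  note f[measurable] = insert.prems(3)
  have [measurable]: "T k \<in> borel_measurable borel" if "k \<in> insert i S" for k using insert.prems(1) that by auto
  have sp: "space N = UNIV" using sets_eq_imp_space_eq[OF assms(3)] by simp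
  have Tm[measurable]: "(\<lambda>x. \<lambda>k\<in>S. T k (x k)) \<in> measurable (PiM S (\<lambda>_. N)) (PiM S (\<lambda>_. N))"
    by (rule measurable_restrict) (use insert.prems(1) in measurable)
  have Tm'[measurable]: "(\<lambda>x. \<lambda>k\<in>insert i S. T k (x k)) \<in> measurable (PiM (insert i S) (\<lambda>_. N)) (PiM (insert i S) (\<lambda>_. N))"
    by (rule measurable_restrict) (use insert.prems(1) in measurable)
  define G where "G z = (\<integral>\<^sup>+y. f (z(i := y)) \<partial>N)" for z
  have Gm[measurable]: "G \<in> borel_measurable (PiM S (\<lambda>_. N))"
    unfolding G_def by measurable
  have "(\<integral>\<^sup>+x. f (\<lambda>k\<in>insert i S. T k (x k)) \<partial>PiM (insert i S) (\<lambda>_. N))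
      = (\<integral>\<^sup>+x. (\<integral>\<^sup>+y. f (\<lambda>k\<in>insert i S. T k ((x(i := y)) k)) \<partial>N) \<partial>PiM S (\<lambda>_. N))"
    using insert.hyps by (subst product_nn_integral_insert) auto
  also have "\<dots> \<le> (\<integral>\<^sup>+x. c i * G (\<lambda>k\<in>S. T k (x k)) \<partial>PiM S (\<lambda>_. N))"
  proof (rule nn_integral_mono)
    fix x assume x: "x \<in> space (PiM S (\<lambda>_. N))"
    define z where "z = (\<lambda>k\<in>S. T k (x k))"
    have z: "z \<in> space (PiM S (\<lambda>_. N))" unfolding z_def by (auto simp: space_PiM sp)
    have "(\<lambda>k\<in>insert i S. T k ((x(i := y)) k)) = z(i := T i y)" for y
      using insert.hyps by (auto simp: z_def fun_eq_iff)
    moreover have "(\<lambda>y. f (z(i := y))) \<in> borel_measurable N" using z by measurable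
    then have "(\<lambda>y. f (z(i := y))) \<in> borel_measurable borel"
      by (simp add: measurable_cong_sets[OF assms(3) refl])
    ultimately show "(\<integral>\<^sup>+y. f (\<lambda>k\<in>insert i S. T k ((x(i := y)) k)) \<partial>N) \<le> c i * G (\<lambda>k\<in>S. T k (x k))"
      using insert.prems(2)[of i "\<lambda>y. f (z(i := y))"] by (simp add: G_def z_def)
  qed
  also have "\<dots> = c i * (\<integral>\<^sup>+x. G (\<lambda>k\<in>S. T k (x k)) \<partial>PiM S (\<lambda>_. N))"
    by (rule nn_integral_cmult) measurable
  also have "\<dots> \<le> c i * ((\<Prod>i\<in>S. c i) * (\<integral>\<^sup>+x. G x \<partial>PiM S (\<lambda>_. N)))"
    using insert.prems by (intro mult_left_mono insert.IH) auto
  also have "\<dots> = (\<Prod>i\<in>insert i S. c i) * (\<integral>\<^sup>+x. f x \<partial>PiM (insert i S) (\<lambda>_. N))"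
    using insert.hyps unfolding G_def by (subst product_nn_integral_insert) (auto simp: mult.assoc)
  finally show ?case .
qed

section \<open>Exponential moments of Gaussian vectors\<close>

lemma nn_integral_normal_mgf:
  "(\<integral>\<^sup>+y. ennreal (exp (a * (y - m))) \<partial>density lborel (normal_density m 1)) = ennreal (exp (a\<^sup>2 / 2))"
proof -
  have "(\<integral>\<^sup>+y. ennreal (exp (a * (y - m))) \<partial>density lborel (normal_density m 1))
    = (\<integral>\<^sup>+y. ennreal (exp (a\<^sup>2 / 2)) * ennreal (normal_density (m + a) 1 y) \<partial>lborel)"
    by (subst nn_integral_density)
       (auto intro!: nn_integral_cong
         simp: ennreal_mult[symmetric] normal_density_def exp_add[symmetric] power2_eq_square field_simps)
  also have "\<dots> = ennreal (exp (a\<^sup>2 / 2)) * (\<integral>\<^sup>+y. ennreal (normal_density (m + a) 1 y) \<partial>lborel)"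
    by (rule nn_integral_cmult) auto
  also have "(\<integral>\<^sup>+y. ennreal (normal_density (m + a) 1 y) \<partial>lborel) = 1"
    by (simp add: nn_integral_eq_integral normal_density_nonneg)
  finally show ?thesis by simp
qed

lemma product_prob_space_normal: "product_prob_space (\<lambda>j. density lborel (normal_density (\<mu> j) 1))"
  by (intro product_prob_spaceI prob_space_normal_density) simp

lemma nn_integral_PiM_normal_mgf:
  fixes a \<mu> :: "nat \<Rightarrow> real"
  shows "(\<integral>\<^sup>+Y. ennreal (exp (\<Sum>j<n. a j * (Y j - \<mu> j))) \<partial>PiM {..<n} (\<lambda>j. density lborel (normal_density (\<mu> j) 1)))
     = ennreal (exp ((\<Sum>j<n. (a j)\<^sup>2) / 2))"
proof -
  interpret product_prob_space "\<lambda>j. density lborel (normal_density (\<mu> j) 1)" "{..<n}"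
    by (rule product_prob_space_normal)
  have "(\<integral>\<^sup>+Y. ennreal (exp (\<Sum>j<n. a j * (Y j - \<mu> j))) \<partial>PiM {..<n} (\<lambda>j. density lborel (normal_density (\<mu> j) 1)))
    = (\<integral>\<^sup>+Y. (\<Prod>j<n. ennreal (exp (a j * (Y j - \<mu> j)))) \<partial>PiM {..<n} (\<lambda>j. density lborel (normal_density (\<mu> j) 1)))"
    by (simp add: exp_sum prod_ennreal)
  also have "\<dots> = (\<Prod>j<n. ennreal (exp ((a j)\<^sup>2 / 2)))"
    by (subst product_nn_integral_prod) (auto simp: nn_integral_normal_mgf)
  also have "\<dots> = ennreal (exp ((\<Sum>j<n. (a j)\<^sup>2) / 2))"
    by (simp add: prod_ennreal exp_sum sum_divide_distrib)
  finally show ?thesis .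
qed

section \<open>The design matrix and the compatibility number\<close>

definition dot :: "nat \<Rightarrow> (nat \<Rightarrow> real) \<Rightarrow> (nat \<Rightarrow> real) \<Rightarrow> real" where
  "dot n u v = (\<Sum>j<n. u j * v j)"

lemma dot_commute: "dot n u v = dot n v u"
  by (simp add: dot_def mult.commute)

lemma dot_add_left: "dot n (\<lambda>j. u j + v j) w = dot n u w + dot n v w"
  by (simp add: dot_def sum.distrib algebra_simps)

lemma dot_scale_left: "dot n (\<lambda>j. c * u j) w = c * dot n u w"
  by (simp add: dot_def sum_distrib_left algebra_simps)

lemma dot_diff_left: "dot n (\<lambda>j. u j - v j) w = dot n u w - dot n v w"
  by (simp add: dot_def sum_subtractf algebra_simps)

lemma dot_diff_right: "dot n w (\<lambda>j. u j - v j) = dot n w u - dot n w v"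
  by (simp add: dot_def sum_subtractf algebra_simps)

lemma dot_add_right: "dot n w (\<lambda>j. u j + v j) = dot n w u + dot n w v"
  by (simp add: dot_def sum.distrib algebra_simps)

lemma dot_scale_right: "dot n w (\<lambda>j. c * u j) = c * dot n w u"
  by (simp add: dot_def sum_distrib_left algebra_simps)

lemmas dot_simps = dot_add_left dot_scale_left dot_diff_left dot_add_right dot_scale_right dot_diff_right

lemma dot_self_nonneg: "dot n u u \<ge> 0"
  by (simp add: dot_def sum_nonneg)

lemma l2norm_squared: "(l2norm n u)\<^sup>2 = dot n u u"
  by (simp add: l2norm_def dot_def power2_eq_square[symmetric] sum_nonneg)

lemma Xmul_add: "Xmul p X (\<lambda>i. a i + b i) = (\<lambda>j. Xmul p X a j + Xmul p X b j)"
  by (simp add: Xmul_def sum.distrib algebra_simps)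

lemma Xmul_uminus: "Xmul p X (\<lambda>i. - b i) = (\<lambda>j. - Xmul p X b j)"
  by (simp add: Xmul_def sum_negf)

lemma Xmul_cong: "(\<And>i. i < p \<Longrightarrow> a i = b i) \<Longrightarrow> Xmul p X a = Xmul p X b"
  by (simp add: Xmul_def)

lemma dot_Xmul: "dot n u (Xmul p X b) = (\<Sum>i<p. b i * dot n u (\<lambda>j. X j i))"
proof -
  have "dot n u (Xmul p X b) = (\<Sum>j<n. \<Sum>i<p. b i * (u j * X j i))"
    by (simp add: dot_def Xmul_def sum_distrib_left algebra_simps)
  also have "\<dots> = (\<Sum>i<p. \<Sum>j<n. b i * (u j * X j i))" by (rule sum.swap)
  finally show ?thesis by (simp add: dot_def sum_distrib_left)
qed

lemma abs_dot_Xmul_le: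
  assumes "\<And>i. i < p \<Longrightarrow> \<bar>dot n u (\<lambda>j. X j i)\<bar> \<le> K"
  shows "\<bar>dot n u (Xmul p X b)\<bar> \<le> K * l1on {..<p} b"
proof -
  have "\<bar>dot n u (Xmul p X b)\<bar> \<le> (\<Sum>i<p. \<bar>b i\<bar> * \<bar>dot n u (\<lambda>j. X j i)\<bar>)"
    unfolding dot_Xmul using sum_abs[of "\<lambda>i. b i * dot n u (\<lambda>j. X j i)" "{..<p}"] by (simp add: abs_mult)
  also have "\<dots> \<le> (\<Sum>i<p. \<bar>b i\<bar> * K)"
    using assms by (intro sum_mono mult_left_mono) auto
  finally show ?thesis by (simp add: l1on_def sum_distrib_left mult.commute)
qed

lemma column_norm_le:
  assumes "i < p"
  shows "dot n (\<lambda>j. X j i) (\<lambda>j. X j i) \<le> (colnorm n p X)\<^sup>2"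
proof -
  have "sqrt (\<Sum>j<n. (X j i)\<^sup>2) \<le> colnorm n p X"
    unfolding colnorm_def using assms by (intro Max_ge) auto
  then have "(sqrt (\<Sum>j<n. (X j i)\<^sup>2))\<^sup>2 \<le> (colnorm n p X)\<^sup>2"
    by (intro power_mono) (auto intro: sum_nonneg)
  then show ?thesis by (simp add: dot_def power2_eq_square[symmetric] sum_nonneg)
qed

text \<open>The squared form of the triangle inequality over the columns in \<open>S\<close>,
  obtained from Cauchy-Schwarz in each row followed by an exchange of the two sums.\<close>

lemma Xmul_box_le:
  assumes S: "S \<subseteq> {..<p}" and b: "\<And>i. i \<in> S \<Longrightarrow> \<bar>b i\<bar> \<le> \<rho>"
  shows "dot n (Xmul p X (zero_ext S b)) (Xmul p X (zero_ext S b)) \<le> (real (card S) * \<rho> * colnorm n p X)\<^sup>2"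
proof -
  have eq: "Xmul p X (zero_ext S b) j = (\<Sum>i\<in>S. X j i * b i)" for j
  proof -
    have "(\<Sum>i<p. X j i * zero_ext S b i) = (\<Sum>i\<in>S. X j i * zero_ext S b i)"
      using S by (intro sum.mono_neutral_right) (auto simp: zero_ext_def)
    then show ?thesis by (simp add: Xmul_def zero_ext_def)
  qed
  have "dot n (Xmul p X (zero_ext S b)) (Xmul p X (zero_ext S b)) = (\<Sum>j<n. (\<Sum>i\<in>S. X j i * b i)\<^sup>2)"
    by (simp add: dot_def eq power2_eq_square)
  also have "\<dots> \<le> (\<Sum>j<n. \<Sum>i\<in>S. real (card S) * \<rho>\<^sup>2 * (X j i)\<^sup>2)"
  proof (rule sum_mono)
    fix j
    have "(\<Sum>i\<in>S. X j i * b i)\<^sup>2 \<le> (\<Sum>i\<in>S. (X j i * b i)\<^sup>2) * card S"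
      by (rule sum_squared_le_sum_of_squares)
    also have "\<dots> \<le> (\<Sum>i\<in>S. (X j i)\<^sup>2 * \<rho>\<^sup>2) * card S"
    proof (intro mult_right_mono sum_mono)
      fix i assume "i \<in> S"
      then have "\<bar>b i\<bar>\<^sup>2 \<le> \<rho>\<^sup>2" using b by (intro power_mono) auto
      then show "(X j i * b i)\<^sup>2 \<le> (X j i)\<^sup>2 * \<rho>\<^sup>2" by (simp add: power_mult_distrib mult_left_mono)
    qed simp
    finally show "(\<Sum>i\<in>S. X j i * b i)\<^sup>2 \<le> (\<Sum>i\<in>S. real (card S) * \<rho>\<^sup>2 * (X j i)\<^sup>2)"
      by (simp add: sum_distrib_left sum_distrib_right algebra_simps)
  qed
  also have "\<dots> = (\<Sum>i\<in>S. \<Sum>j<n. real (card S) * \<rho>\<^sup>2 * (X j i)\<^sup>2)" by (rule sum.swap)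
  also have "\<dots> = (\<Sum>i\<in>S. real (card S) * \<rho>\<^sup>2 * dot n (\<lambda>j. X j i) (\<lambda>j. X j i))"
    by (simp add: dot_def sum_distrib_left power2_eq_square)
  also have "\<dots> \<le> (\<Sum>i\<in>S. real (card S) * \<rho>\<^sup>2 * (colnorm n p X)\<^sup>2)"
    using S by (intro sum_mono mult_left_mono column_norm_le) auto
  also have "\<dots> = (real (card S) * \<rho> * colnorm n p X)\<^sup>2"
    by (simp add: power2_eq_square)
  finally show ?thesis .
qed

section \<open>The compatibility inequality and the cone\<close>

lemma compat_mult_le:
  assumes C: "colnorm n p X > 0" and "finite S" and pos: "l1on S d > 0"
    and cone: "l1on ({..<p} - S) d \<le> 7 * l1on S d"
  shows "compat n p X S * (colnorm n p X * l1on S d) \<le> l2norm n (Xmul p X d) * sqrt (real (card S))"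
proof -
  have ex: "\<exists>i\<in>S. d i \<noteq> 0"
  proof (rule ccontr)
    assume "\<not> ?thesis"
    then have "l1on S d = 0" by (auto simp: l1on_def)
    with pos show False by simp
  qed
  have "compat n p X S \<le> l2norm n (Xmul p X d) * sqrt (real (card S)) / (colnorm n p X * l1on S d)"
    unfolding compat_def
  proof (rule cInf_lower)
    \<comment> \<open>A real \<open>Inf\<close> is a lower bound only for a set bounded below; all
      quotients here are nonnegative.\<close>
    show "bdd_below {l2norm n (Xmul p X \<beta>) * sqrt (real (card S)) / (colnorm n p X * l1on S \<beta>) | \<beta>.
      l1on ({..<p} - S) \<beta> \<le> 7 * l1on S \<beta> \<and> (\<exists>i\<in>S. \<beta> i \<noteq> 0)}"
      using C by (intro bdd_belowI[of _ 0]) (auto simp: l2norm_def l1on_def sum_nonneg)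
  qed (use cone ex in auto)
  then show ?thesis using C pos by (simp add: pos_le_divide_eq)
qed

text \<open>Write a and b for the l1 norms of \<open>d\<close> on \<open>S\<close> and off
  \<open>S\<close>. The three l1 terms, together with the reserve \<open>lam / 4\<close> |d|_1 kept
  for integrating over the coefficients, are at most \<open>lam\<close> (7/4 a - b/4). This is
  positive only if b < 7 a, whence the constant 7 of the cone; inside the cone the compatibility
  number bounds a by |X d|, and the quadratic term pays for it.\<close>

lemma l1_exponent_bound:
  fixes \<beta> \<beta>s :: "nat \<Rightarrow> real"
  assumes C: "colnorm n p X > 0" and p: "p \<ge> 2" and lam: "lam > 0"
    and phi: "supp p \<beta>s = {} \<or> compat n p X (supp p \<beta>s) > 0"
  defines "d \<equiv> \<lambda>i. \<beta> i - \<beta>s i" and "S \<equiv> supp p \<beta>s"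
  shows "lam * l1on {..<p} \<beta>s - lam * l1on {..<p} \<beta> + lam / 2 * l1on {..<p} d
      - lam / (2 * lambar n p X) / 4 * dot n (Xmul p X d) (Xmul p X d)
    \<le> 49 / 2 * (lam / lambar n p X) * real (card S) * ln (real p) / (compat n p X S)\<^sup>2
        - lam / 4 * l1on {..<p} d"
proof -
  have S: "S \<subseteq> {..<p}" "finite S" by (auto simp: S_def supp_def)
  have split: "l1on {..<p} v = l1on S v + l1on ({..<p} - S) v" for v
    unfolding l1on_def using S by (metis add.commute finite_lessThan sum.subset_diff)
  define a where "a = l1on S d"
  define b where "b = l1on ({..<p} - S) d"
  have ab: "a \<ge> 0" "b \<ge> 0" by (auto simp: a_def b_def l1on_def sum_nonneg)
  have off: "\<beta>s i = 0" if "i \<in> {..<p} - S" for i using that by (auto simp: S_def supp_def)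
  have "l1on ({..<p} - S) \<beta> = b" unfolding b_def l1on_def d_def using off by (intro sum.cong) auto
  moreover have "l1on ({..<p} - S) \<beta>s = 0" unfolding l1on_def using off by (intro sum.neutral) auto
  moreover have "l1on S \<beta>s - l1on S \<beta> \<le> a"
    unfolding l1on_def a_def d_def sum_subtractf[symmetric] by (intro sum_mono) auto
  ultimately have le: "l1on {..<p} \<beta>s - l1on {..<p} \<beta> \<le> a - b" using split[of \<beta>s] split[of \<beta>] by linarith
  define Q where "Q = l2norm n (Xmul p X d)"
  define lb where "lb = lambar n p X"
  have lnp: "ln (real p) > 0" using p by simp
  have lb: "lb > 0" unfolding lb_def lambar_def using C lnp by simp
  define R where "R = 49 / 2 * (lam / lb) * real (card S) * ln (real p) / (compat n p X S)\<^sup>2"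
  have R0: "R \<ge> 0" unfolding R_def using lam lb lnp by simp
  have key: "7 / 4 * a - b / 4 \<le> (R + lam / (8 * lb) * Q\<^sup>2) / lam"
  proof (cases "a > 0 \<and> b \<le> 7 * a")
    case True
    then have ne: "S \<noteq> {}" by (auto simp: a_def l1on_def)
    define \<phi> where "\<phi> = compat n p X S"
    have \<phi>: "\<phi> > 0" using phi ne by (simp add: \<phi>_def S_def)
    define k where "k = sqrt (real (card S)) / (\<phi> * colnorm n p X)"
    have "\<phi> * (colnorm n p X * a) \<le> Q * sqrt (real (card S))"
      unfolding \<phi>_def a_def Q_def using True by (intro compat_mult_le C S) (auto simp: a_def b_def)
    then have "a \<le> k * Q" using \<phi> C by (simp add: k_def field_simps)
    have lb2: "lb\<^sup>2 = 4 * (colnorm n p X)\<^sup>2 * ln (real p)"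
      unfolding lb_def lambar_def using lnp by (simp add: power_mult_distrib)
    have k2: "k\<^sup>2 = 4 * real (card S) * ln (real p) / (\<phi>\<^sup>2 * lb\<^sup>2)"
      unfolding lb2 k_def using \<phi> C lnp by (simp add: power_mult_distrib power_divide field_simps)
    have RR: "R = 49 / 8 * lam * lb * k\<^sup>2"
      unfolding k2 R_def \<phi>_def[symmetric] using lb \<phi> by (simp add: power2_eq_square field_simps)
    \<comment> \<open>Completing the square in \<open>Q\<close>: the weight is fixed by the
      available \<open>Q\<^sup>2 / (8 * lb)\<close>, and the remaining 49/8 times
      \<open>lb * k\<^sup>2\<close> becomes the constant 49/2 of \<open>R\<close>, since
      \<open>lb\<^sup>2\<close> contains \<open>4 * ln p\<close>.\<close>
    have "0 \<le> 2 * (lb * (7 / 2 * k) - Q / 2)\<^sup>2 / (4 * lb)" using lb by simp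
    also have "\<dots> = 49 / 8 * lb * k\<^sup>2 + Q\<^sup>2 / (8 * lb) - 7 / 4 * (k * Q)"
      using lb by (simp add: power2_eq_square field_simps)
    finally have "7 / 4 * (k * Q) \<le> 49 / 8 * lb * k\<^sup>2 + Q\<^sup>2 / (8 * lb)" by simp
    also have "\<dots> = (R + lam / (8 * lb) * Q\<^sup>2) / lam" unfolding RR using lam lb by (simp add: field_simps)
    finally show ?thesis using \<open>a \<le> k * Q\<close> ab by linarith
  next
    case False
    then have "7 / 4 * a - b / 4 \<le> 0" using ab by (cases "a = 0") auto
    moreover have "0 \<le> (R + lam / (8 * lb) * Q\<^sup>2) / lam" using R0 lam lb by simp
    ultimately show ?thesis by linarith
  qed
  define U where "U = lam / (8 * lb) * Q\<^sup>2"
  have "lam * (7 / 4 * a - b / 4) \<le> R + U"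
    using key lam unfolding U_def[symmetric] by (simp add: pos_le_divide_eq mult.commute)
  moreover have "lam * (l1on {..<p} \<beta>s - l1on {..<p} \<beta>) \<le> lam * (a - b)"
    using le lam by (intro mult_left_mono) auto
  moreover have "l1on {..<p} d = a + b" using split[of d] by (simp add: a_def b_def)
  moreover have "lam / (2 * lb) / 4 * dot n (Xmul p X d) (Xmul p X d) = U"
    by (simp add: Q_def U_def l2norm_squared)
  note U = this
  ultimately show ?thesis
    unfolding U lb_def[symmetric] R_def[symmetric] by (simp add: algebra_simps add_divide_distrib)
qed

section \<open>Lower bound for the evidence\<close>

abbreviation laplace_PiM :: "real \<Rightarrow> nat set \<Rightarrow> (nat \<Rightarrow> real) measure" where
  "laplace_PiM lam S \<equiv> PiM S (\<lambda>_. laplace_measure lam)"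

lemma measurable_zero_ext [measurable]:
  "(\<lambda>x. zero_ext S x i) \<in> borel_measurable (laplace_PiM lam S)"
proof (cases "i \<in> S")
  case True
  then have "(\<lambda>x. x i) \<in> measurable (laplace_PiM lam S) (laplace_measure lam)"
    by (rule measurable_component_singleton)
  then have "(\<lambda>x. x i) \<in> borel_measurable (laplace_PiM lam S)"
    by (simp add: measurable_cong_sets[OF refl sets_laplace_measure])
  then show ?thesis using True by (simp add: zero_ext_def)
qed (simp add: zero_ext_def)

lemma measurable_Xmul_zero_ext [measurable]:
  "(\<lambda>x. Xmul p X (zero_ext S x) j) \<in> borel_measurable (laplace_PiM lam S)"
  unfolding Xmul_def by measurable

lemma lik_eq_dot: "lik n p X Y \<beta> = exp (- dot n (\<lambda>j. Y j - Xmul p X \<beta> j) (\<lambda>j. Y j - Xmul p X \<beta> j) / 2)"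
  by (simp add: lik_def dot_def power2_eq_square)

lemma lik_shift:
  "lik n p X Y (\<lambda>i. \<beta>s i + b i) = lik n p X Y \<beta>s *
     exp (dot n (\<lambda>j. Y j - Xmul p X \<beta>s j) (Xmul p X b) - dot n (Xmul p X b) (Xmul p X b) / 2)"
proof -
  let ?W = "\<lambda>j. Y j - Xmul p X \<beta>s j"
  have "(\<lambda>j. Y j - Xmul p X (\<lambda>i. \<beta>s i + b i) j) = (\<lambda>j. ?W j - Xmul p X b j)"
    by (simp add: Xmul_add algebra_simps)
  then have "lik n p X Y (\<lambda>i. \<beta>s i + b i)
      = exp (- dot n (\<lambda>j. ?W j - Xmul p X b j) (\<lambda>j. ?W j - Xmul p X b j) / 2)"
    by (simp only: lik_eq_dot)
  then show ?thesis
    unfolding lik_eq_dot[of n p X Y \<beta>s] exp_add[symmetric]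
      dot_diff_left[of n ?W] dot_diff_right[of n _ ?W] dot_commute[of n "Xmul p X b" ?W]
    by (simp add: field_simps)
qed

lemma lik_cong: "(\<And>i. i < p \<Longrightarrow> a i = b i) \<Longrightarrow> lik n p X Y a = lik n p X Y b"
  unfolding lik_def by (simp add: Xmul_cong[of p a b])

lemma lik_pos: "lik n p X Y \<beta> > 0"
  by (simp add: lik_def)

lemma nn_integral_laplace_PiM_shift_le:
  assumes "lam > 0" "finite S" "f \<in> borel_measurable (laplace_PiM lam S)"
  shows "(\<integral>\<^sup>+x. f (\<lambda>i\<in>S. x i + a i) \<partial>laplace_PiM lam S)
    \<le> ennreal (exp (lam * l1on S a)) * (\<integral>\<^sup>+x. f x \<partial>laplace_PiM lam S)"
proof -
  have "(\<integral>\<^sup>+x. f (\<lambda>i\<in>S. x i + a i) \<partial>laplace_PiM lam S)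
    \<le> (\<Prod>i\<in>S. ennreal (exp (lam * \<bar>a i\<bar>))) * (\<integral>\<^sup>+x. f x \<partial>laplace_PiM lam S)"
    by (rule nn_integral_PiM_map_le[where T = "\<lambda>i x. x + a i"])
       (use assms in \<open>auto intro!: product_sigma_finite_laplace nn_integral_laplace_shift_le\<close>)
  then show ?thesis
    using assms by (simp add: prod_ennreal exp_sum[symmetric] l1on_def sum_distrib_left)
qed

lemma nn_integral_laplace_PiM_uminus_le:
  assumes "lam > 0" "finite S" "f \<in> borel_measurable (laplace_PiM lam S)"
  shows "(\<integral>\<^sup>+x. f (\<lambda>i\<in>S. - x i) \<partial>laplace_PiM lam S) \<le> (\<integral>\<^sup>+x. f x \<partial>laplace_PiM lam S)"
proof -
  have "(\<integral>\<^sup>+x. f (\<lambda>i\<in>S. - x i) \<partial>laplace_PiM lam S)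
    \<le> (\<Prod>i\<in>S. 1) * (\<integral>\<^sup>+x. f x \<partial>laplace_PiM lam S)"
    by (rule nn_integral_PiM_map_le[where T = "\<lambda>i x. - x"])
       (use assms in \<open>auto intro!: product_sigma_finite_laplace simp: nn_integral_laplace_uminus\<close>)
  then show ?thesis by simp
qed

lemma nn_integral_laplace_box_ge:
  assumes lam: "lam > 0" and p: "p \<ge> 1" and C: "colnorm n p X / real p \<le> lam" "colnorm n p X \<ge> 0"
    and S: "S \<subseteq> {..<p}"
  shows "ennreal (exp (- 1 / 2) * (exp (- 1) / (real p * real (card S))) ^ card S)
    \<le> (\<integral>\<^sup>+x. ennreal (exp (- dot n (Xmul p X (zero_ext S x)) (Xmul p X (zero_ext S x)) / 2)) \<partial>laplace_PiM lam S)"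
proof -
  have fin: "finite S" using S finite_subset by blast
  interpret product_sigma_finite "\<lambda>_::nat. laplace_measure lam"
    by (rule product_sigma_finite_laplace[OF lam])
  define s where "s = card S"
  \<comment> \<open>The radius meets two demands: \<open>lam * \<rho> \<le> 1\<close> keeps the
    Laplace density on the box within a factor e of its peak, and
    \<open>s * \<rho> * colnorm \<le> 1\<close>, where the lower limit on \<open>lam\<close> enters,
    keeps the quadratic form at most 1. For s = 0 division gives radius 0 and the product over
    \<open>S\<close> is empty.\<close>
  define \<rho> where "\<rho> = 1 / (lam * (real p * real s))"
  have \<rho>: "\<rho> \<ge> 0" "lam * \<rho> = 1 / (real p * real s)" using lam by (auto simp: \<rho>_def)
  have "lam * \<rho> \<le> 1"
  proof (cases "s = 0")
    case False
    then have "1 * 1 \<le> real p * real s" using p by (intro mult_mono) auto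
    then show ?thesis using \<rho> by (simp add: divide_le_eq_1)
  qed (simp add: \<rho>(2))
  note box = emeasure_laplace_interval_ge[OF lam \<rho>(1) this]
  have sC: "real s * \<rho> * colnorm n p X \<le> 1"
  proof (cases "s = 0")
    case False
    have "colnorm n p X \<le> lam * real p" using C p by (simp add: divide_le_eq)
    then show ?thesis using False lam p by (simp add: \<rho>_def field_simps)
  qed simp
  have "ennreal (exp (- 1 / 2) * (exp (- 1) / (real p * real s)) ^ s)
      = ennreal (exp (- 1 / 2)) * (\<Prod>i\<in>S. ennreal (lam * \<rho> * exp (- 1)))"
    unfolding \<rho> by (simp add: s_def[symmetric] ennreal_mult[symmetric] ennreal_power mult.commute)
  also have "\<dots> \<le> ennreal (exp (- 1 / 2)) * (\<Prod>i\<in>S. emeasure (laplace_measure lam) {-\<rho>..\<rho>})"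
    by (intro mult_left_mono prod_mono_ennreal box) auto
  also have "\<dots> = ennreal (exp (- 1 / 2)) * (\<integral>\<^sup>+x. (\<Prod>i\<in>S. indicator {-\<rho>..\<rho>} (x i)) \<partial>laplace_PiM lam S)"
    by (subst product_nn_integral_prod) (auto simp: fin)
  also have "\<dots> = (\<integral>\<^sup>+x. ennreal (exp (- 1 / 2)) * (\<Prod>i\<in>S. indicator {-\<rho>..\<rho>} (x i)) \<partial>laplace_PiM lam S)"
    by (rule nn_integral_cmult[symmetric]) measurable
  also have "\<dots> \<le> (\<integral>\<^sup>+x. ennreal (exp (- dot n (Xmul p X (zero_ext S x)) (Xmul p X (zero_ext S x)) / 2)) \<partial>laplace_PiM lam S)"
  proof (rule nn_integral_mono)
    fix x :: "nat \<Rightarrow> real"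
    show "ennreal (exp (- 1 / 2)) * (\<Prod>i\<in>S. indicator {-\<rho>..\<rho>} (x i))
      \<le> ennreal (exp (- dot n (Xmul p X (zero_ext S x)) (Xmul p X (zero_ext S x)) / 2))"
    proof (cases "\<forall>i\<in>S. x i \<in> {-\<rho>..\<rho>}")
      case True
      have "dot n (Xmul p X (zero_ext S x)) (Xmul p X (zero_ext S x)) \<le> (real s * \<rho> * colnorm n p X)\<^sup>2"
        unfolding s_def using True by (intro Xmul_box_le S) (auto simp: abs_le_iff)
      also have "\<dots> \<le> 1" using sC \<rho>(1) C(2) by (intro power_le_one) auto
      finally show ?thesis using True by (auto intro!: ennreal_leI simp: indicator_def)
    next
      case False
      then have "(\<Prod>i\<in>S. indicator {-\<rho>..\<rho>} (x i)) = (0::ennreal)"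
        using fin by (metis indicator_simps(2) prod_zero)
      then show ?thesis by (simp only: mult_zero_right zero_le)
    qed
  qed
  finally show ?thesis by (simp add: s_def)
qed

text \<open>After shifting the prior to be centred at \<open>\<beta>s\<close>, the linear term of the log likelihood ratio
  is odd and disappears because \<open>exp t + exp (- t) \<ge> 2\<close>.\<close>

lemma nn_integral_lik_ge:
  fixes \<beta>s :: "nat \<Rightarrow> real"
  assumes lam: "lam > 0" and p: "p \<ge> 1" and C: "colnorm n p X / real p \<le> lam" "colnorm n p X \<ge> 0"
  defines "S \<equiv> supp p \<beta>s"
  shows "ennreal (lik n p X Y \<beta>s * exp (- lam * l1on {..<p} \<beta>s) *
        (exp (- 1 / 2) * (exp (- 1) / (real p * real (card S))) ^ card S))
    \<le> (\<integral>\<^sup>+x. ennreal (lik n p X Y (zero_ext S x)) \<partial>laplace_PiM lam S)"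
proof -
  have S: "S \<subseteq> {..<p}" and fin: "finite S" by (auto simp: S_def supp_def)
  define W where "W = (\<lambda>j. Y j - Xmul p X \<beta>s j)"
  define q where "q x = dot n (Xmul p X (zero_ext S x)) (Xmul p X (zero_ext S x))" for x
  define G where "G x = ennreal (exp (dot n W (Xmul p X (zero_ext S x)) - q x / 2))" for x
  have [measurable]: "q \<in> borel_measurable (laplace_PiM lam S)"
    "G \<in> borel_measurable (laplace_PiM lam S)"
    unfolding G_def q_def dot_def by measurable
  have neg: "Xmul p X (zero_ext S (\<lambda>i\<in>S. - x i)) = (\<lambda>j. - 1 * Xmul p X (zero_ext S x) j)" for x
  proof -
    have "zero_ext S (\<lambda>i\<in>S. - x i) = (\<lambda>i. - zero_ext S x i)" by (auto simp: zero_ext_def)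
    then show ?thesis by (simp add: Xmul_uminus)
  qed
  have "ennreal 2 * (\<integral>\<^sup>+x. ennreal (exp (- q x / 2)) \<partial>laplace_PiM lam S)
      = (\<integral>\<^sup>+x. ennreal 2 * ennreal (exp (- q x / 2)) \<partial>laplace_PiM lam S)"
    by (rule nn_integral_cmult[symmetric]) measurable
  also have "\<dots> \<le> (\<integral>\<^sup>+x. G x + G (\<lambda>i\<in>S. - x i) \<partial>laplace_PiM lam S)"
  proof (rule nn_integral_mono)
    fix x :: "nat \<Rightarrow> real"
    define t where "t = dot n W (Xmul p X (zero_ext S x))"
    have "2 * exp (- q x / 2) \<le> (exp t + exp (- t)) * exp (- q x / 2)"
      using cosh_real_ge_1[of t] by (intro mult_right_mono) (auto simp: cosh_def)
    also have "\<dots> = exp (t - q x / 2) + exp (- t - q x / 2)"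
      by (simp add: algebra_simps flip: exp_add)
    finally have "ennreal (2 * exp (- q x / 2)) \<le> ennreal (exp (t - q x / 2) + exp (- t - q x / 2))"
      by (rule ennreal_leI)
    moreover have "G (\<lambda>i\<in>S. - x i) = ennreal (exp (- t - q x / 2))"
      unfolding G_def q_def t_def neg dot_scale_left dot_scale_right by simp
    ultimately show "ennreal 2 * ennreal (exp (- q x / 2)) \<le> G x + G (\<lambda>i\<in>S. - x i)"
      by (simp add: G_def t_def ennreal_mult del: ennreal_numeral)
  qed
  also have "\<dots> = (\<integral>\<^sup>+x. G x \<partial>laplace_PiM lam S) + (\<integral>\<^sup>+x. G (\<lambda>i\<in>S. - x i) \<partial>laplace_PiM lam S)"
    by (rule nn_integral_add) (simp_all add: G_def q_def neg dot_def, measurable)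
  also have "\<dots> \<le> (\<integral>\<^sup>+x. G x \<partial>laplace_PiM lam S) + (\<integral>\<^sup>+x. G x \<partial>laplace_PiM lam S)"
    by (intro add_left_mono nn_integral_laplace_PiM_uminus_le lam fin) measurable
  finally have sym: "(\<integral>\<^sup>+x. ennreal (exp (- q x / 2)) \<partial>laplace_PiM lam S) \<le> (\<integral>\<^sup>+x. G x \<partial>laplace_PiM lam S)"
    unfolding mult_2[symmetric] by (simp add: ennreal_mult_le_mult_iff)
  let ?F = "\<lambda>x. ennreal (lik n p X Y (zero_ext S x))"
  let ?e = "exp (- 1 / 2) * (exp (- 1) / (real p * real (card S))) ^ card S"
  have Fm: "?F \<in> borel_measurable (laplace_PiM lam S)" unfolding lik_def by measurable
  \<comment> \<open>As \<open>\<beta>s\<close> vanishes off \<open>S\<close>, adding it on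
    \<open>S\<close> alone is a full recentring and stays inside the model.\<close>
  have Fshift: "?F (\<lambda>i\<in>S. x i + \<beta>s i) = ennreal (lik n p X Y \<beta>s) * G x" for x
  proof -
    have "lik n p X Y (zero_ext S (\<lambda>i\<in>S. x i + \<beta>s i)) = lik n p X Y (\<lambda>i. \<beta>s i + zero_ext S x i)"
      by (rule lik_cong) (auto simp: zero_ext_def S_def supp_def)
    then show ?thesis unfolding lik_shift G_def W_def q_def
      by (simp add: ennreal_mult[symmetric] lik_pos less_imp_le)
  qed
  have l1: "l1on S \<beta>s = l1on {..<p} \<beta>s"
    unfolding l1on_def using S by (intro sum.mono_neutral_left) (auto simp: S_def supp_def)
  have "ennreal (lik n p X Y \<beta>s) * ennreal ?e \<le> ennreal (lik n p X Y \<beta>s) * (\<integral>\<^sup>+x. G x \<partial>laplace_PiM lam S)"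
    using nn_integral_laplace_box_ge[OF lam p C S] sym unfolding q_def
    by (intro mult_left_mono) auto
  also have "\<dots> = (\<integral>\<^sup>+x. ?F (\<lambda>i\<in>S. x i + \<beta>s i) \<partial>laplace_PiM lam S)"
    unfolding Fshift by (rule nn_integral_cmult[symmetric]) measurable
  also have "\<dots> \<le> ennreal (exp (lam * l1on {..<p} \<beta>s)) * (\<integral>\<^sup>+x. ?F x \<partial>laplace_PiM lam S)"
    unfolding l1[symmetric] by (rule nn_integral_laplace_PiM_shift_le[OF lam fin Fm])
  finally have "ennreal (exp (- lam * l1on {..<p} \<beta>s)) * (ennreal (lik n p X Y \<beta>s) * ennreal ?e)
     \<le> ennreal (exp (- lam * l1on {..<p} \<beta>s)) * (ennreal (exp (lam * l1on {..<p} \<beta>s)) * (\<integral>\<^sup>+x. ?F x \<partial>laplace_PiM lam S))"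
    by (rule mult_left_mono) simp
  also have "\<dots> = (\<integral>\<^sup>+x. ?F x \<partial>laplace_PiM lam S)"
    by (simp add: mult.assoc[symmetric] ennreal_mult[symmetric] exp_add[symmetric])
  finally show ?thesis
    by (simp add: ennreal_mult[symmetric] lik_pos less_imp_le mult_ac)
qed

text \<open>One term of the exponential series. It trades the \<open>s ^ s\<close> lost through the
  box radius for \<open>exp s\<close>, using the factorial in the binomial coefficient.\<close>

lemma power_card_le_exp_fact: "real s ^ s \<le> exp (real s) * fact s"
proof -
  have "(\<Sum>k\<in>{s}. real s ^ k / fact k) \<le> exp (real s)"
    unfolding exp_def using summable_exp[of "real s"]
    by (intro sum_le_suminf[where I = "{s}", THEN order_trans]) (auto simp: divide_inverse mult.commute)
  then show ?thesis by (simp add: field_simps)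
qed

text \<open>All models except the support of \<open>\<beta>s\<close> are discarded. The factor
  \<open>exp (- lam * l1on {..<p} \<beta>s)\<close> is kept exactly: it reappears in the bound for
  the numerator and cancels there, which makes the final bound uniform in
  \<open>\<beta>s\<close>.\<close>

lemma prior_nn_lik_ge:
  fixes \<beta>s :: "nat \<Rightarrow> real"
  assumes lam: "lam > 0" and p: "p \<ge> 1" and C: "colnorm n p X / real p \<le> lam" "colnorm n p X \<ge> 0"
    and pis: "\<And>s. s \<le> p \<Longrightarrow> pis s \<ge> 0"
  defines "s \<equiv> card (supp p \<beta>s)"
  shows "ennreal (lik n p X Y \<beta>s * (exp (- lam * l1on {..<p} \<beta>s) * exp (- 1 / 2) * pis s / (real p * exp 1) ^ (2 * s)))
    \<le> prior_nn p lam pis (\<lambda>\<beta>. ennreal (lik n p X Y \<beta>))"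
proof -
  define S where "S = supp p \<beta>s"
  have S: "S \<subseteq> {..<p}" by (auto simp: S_def supp_def)
  have s: "card S = s" by (simp add: S_def s_def)
  have sp: "s \<le> p" using card_mono[OF _ S] s by simp
  let ?I = "\<lambda>S. \<integral>\<^sup>+x. ennreal (lik n p X Y (zero_ext S x)) \<partial>laplace_PiM lam S"
  define u where "u = lik n p X Y \<beta>s * exp (- lam * l1on {..<p} \<beta>s) * exp (- 1 / 2) * pis s"
  have u: "u \<ge> 0" unfolding u_def using pis[OF sp] by (simp add: lik_pos less_imp_le)
  \<comment> \<open>One factor \<open>(p * e) ^ s\<close> is the box mass without its
    \<open>s ^ s\<close>; the other bounds the binomial coefficient times
    \<open>s ^ s\<close>.\<close>
  have comb: "1 / (real p * exp 1) ^ (2 * s) \<le> 1 / real (p choose s) * (exp (- 1) / (real p * real s)) ^ s"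
  proof (cases "s = 0")
    case False
    have "real (p choose s) * real s ^ s \<le> real (p choose s) * (exp (real s) * fact s)"
      by (intro mult_left_mono power_card_le_exp_fact) simp
    also have "\<dots> = exp (real s) * real ((p choose s) * fact s)" by simp
    also have "\<dots> \<le> exp (real s) * real (p ^ s)"
      by (intro mult_left_mono) (auto simp only: of_nat_le_iff binomial_fact_pow exp_ge_zero)
    finally have "real (p choose s) * real s ^ s \<le> exp (real s) * real p ^ s" by simp
    then have "(real (p choose s) * real s ^ s) * (exp (real s) * real p ^ s)
       \<le> (exp (real s) * real p ^ s) * (exp (real s) * real p ^ s)"
      by (intro mult_right_mono) auto
    moreover have "exp (real s) = exp 1 ^ s" by (simp add: exp_of_nat_mult[symmetric])
    moreover have "real (p choose s) > 0" using sp by (simp add: zero_less_binomial_iff)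
    ultimately show ?thesis
      using False p
      by (simp add: power_mult power_mult_distrib power_divide exp_minus power2_eq_square field_simps)
  qed simp
  have "lik n p X Y \<beta>s * (exp (- lam * l1on {..<p} \<beta>s) * exp (- 1 / 2) * pis s / (real p * exp 1) ^ (2 * s))
     = u * (1 / (real p * exp 1) ^ (2 * s))" by (simp add: u_def)
  also have "\<dots> \<le> u * (1 / real (p choose s) * (exp (- 1) / (real p * real s)) ^ s)"
    by (intro mult_left_mono comb u)
  also have "\<dots> = pis s / real (p choose s) * (lik n p X Y \<beta>s * exp (- lam * l1on {..<p} \<beta>s) *
        (exp (- 1 / 2) * (exp (- 1) / (real p * real s)) ^ s))" by (simp add: u_def)
  finally have "ennreal (lik n p X Y \<beta>s * (exp (- lam * l1on {..<p} \<beta>s) * exp (- 1 / 2) * pis s / (real p * exp 1) ^ (2 * s)))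
     \<le> ennreal (pis s / real (p choose s) * (lik n p X Y \<beta>s * exp (- lam * l1on {..<p} \<beta>s) *
        (exp (- 1 / 2) * (exp (- 1) / (real p * real s)) ^ s)))" by (rule ennreal_leI)
  also have "\<dots> = ennreal (pis s / real (p choose s)) * ennreal (lik n p X Y \<beta>s * exp (- lam * l1on {..<p} \<beta>s) *
        (exp (- 1 / 2) * (exp (- 1) / (real p * real s)) ^ s))"
    using pis[OF sp] by (intro ennreal_mult) (auto simp: lik_pos less_imp_le)
  also have "\<dots> \<le> ennreal (pis s / real (p choose s)) * ?I S"
    using nn_integral_lik_ge[OF lam p C, of Y \<beta>s] s by (intro mult_left_mono) (auto simp: S_def)
  also have "\<dots> \<le> ennreal (pis s / real (p choose s)) * (\<Sum>S\<in>{S. S \<subseteq> {..<p} \<and> card S = s}. ?I S)"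
    using S s by (intro mult_left_mono member_le_sum) (auto intro: finite_subset[of _ "Pow {..<p}"])
  also have "\<dots> \<le> prior_nn p lam pis (\<lambda>\<beta>. ennreal (lik n p X Y \<beta>))"
    unfolding prior_nn_def using sp
    by (intro member_le_sum[where f = "\<lambda>s. ennreal (pis s / real (p choose s)) * (\<Sum>S\<in>{S. S \<subseteq> {..<p} \<and> card S = s}. ?I S)"]) auto
  finally show ?thesis .
qed

section \<open>Gaussian expectation of tilted likelihood ratios\<close>

lemma sets_data_measure [measurable_cong]:
  "sets (data_measure n p X \<beta>0) = sets (PiM {..<n} (\<lambda>_. borel))"
  unfolding data_measure_def by (intro sets_PiM_cong) auto

lemma sigma_finite_data_measure: "sigma_finite_measure (data_measure n p X \<beta>0)"
  unfolding data_measure_def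
  by (intro prob_space_imp_sigma_finite prob_space_PiM prob_space_normal_density) simp

lemma sigma_finite_laplace_PiM:
  assumes "lam > 0" "finite S"
  shows "sigma_finite_measure (laplace_PiM lam S)"
proof -
  interpret product_sigma_finite "\<lambda>_::nat. laplace_measure lam"
    by (rule product_sigma_finite_laplace[OF assms(1)])
  show ?thesis by (rule sigma_finite[OF assms(2)])
qed

lemma measurable_dot_data [measurable]:
  assumes "\<And>j. j < n \<Longrightarrow> (\<lambda>z. a z j) \<in> borel_measurable M" "Y \<in> measurable M (data_measure n p X \<beta>0)"
  shows "(\<lambda>z. dot n (a z) (\<lambda>j. Y z j - c j)) \<in> borel_measurable M"
proof -
  have "(\<lambda>Y. Y j) \<in> borel_measurable (data_measure n p X \<beta>0)" if "j < n" for j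
    using that by (subst measurable_cong_sets[OF sets_data_measure refl]) simp
  then have "(\<lambda>z. Y z j) \<in> borel_measurable M" if "j < n" for j
    using measurable_compose[OF assms(2)] that by blast
  then show ?thesis
    unfolding dot_def using assms(1)
    by (intro borel_measurable_sum borel_measurable_times borel_measurable_diff) auto
qed

text \<open>The constant \<open>c\<close> sits inside the exponent so that one rule evaluates the
  noise tail, \<open>data_lr\<close> and \<open>tilted_lr\<close> alike.\<close>

lemma nn_integral_data_mgf:
  "(\<integral>\<^sup>+Y. ennreal (exp (dot n a (\<lambda>j. Y j - Xmul p X \<beta>0 j) + c)) \<partial>data_measure n p X \<beta>0)
    = ennreal (exp (dot n a a / 2 + c))"
proof -
  have "(\<integral>\<^sup>+Y. ennreal (exp (dot n a (\<lambda>j. Y j - Xmul p X \<beta>0 j) + c)) \<partial>data_measure n p X \<beta>0)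
    = (\<integral>\<^sup>+Y. ennreal (exp (dot n a (\<lambda>j. Y j - Xmul p X \<beta>0 j))) * ennreal (exp c) \<partial>data_measure n p X \<beta>0)"
    by (simp add: exp_add ennreal_mult)
  also have "\<dots> = (\<integral>\<^sup>+Y. ennreal (exp (dot n a (\<lambda>j. Y j - Xmul p X \<beta>0 j))) \<partial>data_measure n p X \<beta>0) * ennreal (exp c)"
    by (rule nn_integral_multc) measurable
  also have "(\<integral>\<^sup>+Y. ennreal (exp (dot n a (\<lambda>j. Y j - Xmul p X \<beta>0 j))) \<partial>data_measure n p X \<beta>0) = ennreal (exp (dot n a a / 2))"
    using nn_integral_PiM_normal_mgf[where n = n and a = a and \<mu> = "Xmul p X \<beta>0"]
    by (simp add: dot_def data_measure_def power2_eq_square)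
  finally show ?thesis by (simp add: exp_add ennreal_mult)
qed

text \<open>A Chernoff majorant of the indicator that some column correlates with the noise beyond
  \<open>lambar\<close>: each summand is exp (t (\<sigma> <X_i, noise> - \<open>lambar\<close>))
  with t = \<open>lambar / colnorm\<^sup>2\<close>, the optimal slope for variance
  \<open>colnorm\<^sup>2\<close>. The sum over columns and signs is the union bound.\<close>

definition noise_tail :: "nat \<Rightarrow> nat \<Rightarrow> (nat \<Rightarrow> nat \<Rightarrow> real) \<Rightarrow> (nat \<Rightarrow> real) \<Rightarrow> (nat \<Rightarrow> real) \<Rightarrow> ennreal" where
  "noise_tail n p X \<beta>0 Y = (\<Sum>i<p. \<Sum>\<sigma>\<in>{-1, 1}.
     ennreal (exp (dot n (\<lambda>j. \<sigma> * lambar n p X / (colnorm n p X)\<^sup>2 * X j i) (\<lambda>j. Y j - Xmul p X \<beta>0 j)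
        + - ((lambar n p X)\<^sup>2 / (colnorm n p X)\<^sup>2))))"

lemma measurable_noise_tail [measurable]:
  "noise_tail n p X \<beta>0 \<in> borel_measurable (data_measure n p X \<beta>0)"
  unfolding noise_tail_def by measurable

text \<open>With v = \<open>lambar\<^sup>2 / colnorm\<^sup>2\<close> = 4 ln p, each of the 2 p
  summands has mean at most exp (v / 2 - v) = 1 / p^2.\<close>

lemma nn_integral_noise_tail_le:
  assumes C: "colnorm n p X > 0" and p: "p \<ge> 2"
  shows "(\<integral>\<^sup>+Y. noise_tail n p X \<beta>0 Y \<partial>data_measure n p X \<beta>0) \<le> ennreal (2 / real p)"
proof -
  define t where "t = lambar n p X / (colnorm n p X)\<^sup>2"
  define v where "v = (lambar n p X)\<^sup>2 / (colnorm n p X)\<^sup>2"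
  have v: "v = 4 * ln (real p)" unfolding v_def lambar_def using C p by (simp add: power_mult_distrib)
  have "(\<integral>\<^sup>+Y. noise_tail n p X \<beta>0 Y \<partial>data_measure n p X \<beta>0)
    = (\<Sum>i<p. \<Sum>\<sigma>\<in>{-1, 1}. ennreal (exp (dot n (\<lambda>j. \<sigma> * t * X j i) (\<lambda>j. \<sigma> * t * X j i) / 2 + - v)))"
    unfolding noise_tail_def times_divide_eq_right[symmetric] t_def[symmetric] v_def[symmetric]
    by (subst nn_integral_sum, measurable, subst nn_integral_sum, measurable, subst nn_integral_data_mgf, rule refl)
  also have "\<dots> \<le> (\<Sum>i<p. \<Sum>\<sigma>\<in>{-1, 1::real}. ennreal (1 / (real p)\<^sup>2))"
  proof (intro sum_mono ennreal_leI)
    fix i and \<sigma> :: real assume i: "i \<in> {..<p}" and \<sigma>: "\<sigma> \<in> {-1, 1}"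
    then have "dot n (\<lambda>j. \<sigma> * t * X j i) (\<lambda>j. \<sigma> * t * X j i) = t\<^sup>2 * dot n (\<lambda>j. X j i) (\<lambda>j. X j i)"
      unfolding dot_scale_left[of n "\<sigma> * t"] dot_scale_right[of n _ "\<sigma> * t"]
      by (auto simp: power2_eq_square)
    also have "\<dots> \<le> t\<^sup>2 * (colnorm n p X)\<^sup>2"
      using i by (intro mult_left_mono column_norm_le) auto
    also have "\<dots> = v" using C by (simp add: t_def v_def power2_eq_square)
    finally have "exp (dot n (\<lambda>j. \<sigma> * t * X j i) (\<lambda>j. \<sigma> * t * X j i) / 2 + - v) \<le> exp (- (2 * ln (real p)))"
      by (simp add: v)
    also have "\<dots> = 1 / (real p)\<^sup>2"
      using p by (simp only: exp_minus mult_2 exp_add exp_ln of_nat_0_less_iff power2_eq_square inverse_eq_divide)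
    finally show "exp (dot n (\<lambda>j. \<sigma> * t * X j i) (\<lambda>j. \<sigma> * t * X j i) / 2 + - v) \<le> 1 / (real p)\<^sup>2" .
  qed
  also have "\<dots> = ennreal (\<Sum>i<p. \<Sum>\<sigma>\<in>{-1, 1::real}. 1 / (real p)\<^sup>2)"
    by (simp only: sum_ennreal sum_nonneg zero_le_divide_1_iff zero_le_power2)
  also have "\<dots> = ennreal (2 / real p)"
    using p by (simp add: power2_eq_square)
  finally show ?thesis .
qed

lemma noise_tail_ge_1:
  assumes C: "colnorm n p X > 0" and p: "p \<ge> 2" and i: "i < p"
    and big: "\<bar>dot n (\<lambda>j. Y j - Xmul p X \<beta>0 j) (\<lambda>j. X j i)\<bar> > lambar n p X"
  shows "noise_tail n p X \<beta>0 Y \<ge> 1"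
proof -
  define \<epsilon> where "\<epsilon> = (\<lambda>j. Y j - Xmul p X \<beta>0 j)"
  define \<sigma> :: real where "\<sigma> = (if dot n \<epsilon> (\<lambda>j. X j i) \<ge> 0 then 1 else -1)"
  have lb: "lambar n p X \<ge> 0" unfolding lambar_def using C p by simp
  have "lambar n p X \<le> \<sigma> * dot n \<epsilon> (\<lambda>j. X j i)"
    using big by (auto simp: \<sigma>_def \<epsilon>_def)
  then have "lambar n p X / (colnorm n p X)\<^sup>2 * lambar n p X
     \<le> lambar n p X / (colnorm n p X)\<^sup>2 * (\<sigma> * dot n \<epsilon> (\<lambda>j. X j i))"
    using lb by (intro mult_left_mono) auto
  also have "\<dots> = dot n (\<lambda>j. \<sigma> * lambar n p X / (colnorm n p X)\<^sup>2 * X j i) \<epsilon>"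
    unfolding dot_scale_left by (simp add: dot_commute)
  finally have "1 \<le> exp (dot n (\<lambda>j. \<sigma> * lambar n p X / (colnorm n p X)\<^sup>2 * X j i) \<epsilon>
        + - ((lambar n p X)\<^sup>2 / (colnorm n p X)\<^sup>2))"
    by (simp add: power2_eq_square)
  then have "1 \<le> ennreal (exp (dot n (\<lambda>j. \<sigma> * lambar n p X / (colnorm n p X)\<^sup>2 * X j i) \<epsilon>
        + - ((lambar n p X)\<^sup>2 / (colnorm n p X)\<^sup>2)))"
    using ennreal_leI by fastforce
  also have "\<dots> \<le> (\<Sum>\<sigma>\<in>{-1, 1}. ennreal (exp (dot n (\<lambda>j. \<sigma> * lambar n p X / (colnorm n p X)\<^sup>2 * X j i) \<epsilon>
        + - ((lambar n p X)\<^sup>2 / (colnorm n p X)\<^sup>2))))"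
    by (rule member_le_sum) (auto simp: \<sigma>_def)
  also have "\<dots> \<le> noise_tail n p X \<beta>0 Y"
    unfolding noise_tail_def \<epsilon>_def
    by (rule member_le_sum[where f = "\<lambda>i. \<Sum>\<sigma>\<in>{-1, 1}. ennreal (exp (dot n (\<lambda>j. \<sigma> * lambar n p X / (colnorm n p X)\<^sup>2 * X j i) _ + _))"])
       (use i in auto)
  finally show ?thesis .
qed

definition bias :: "nat \<Rightarrow> (nat \<Rightarrow> nat \<Rightarrow> real) \<Rightarrow> (nat \<Rightarrow> real) \<Rightarrow> (nat \<Rightarrow> real) \<Rightarrow> nat \<Rightarrow> real" where
  "bias p X \<beta>0 \<beta>s = (\<lambda>j. Xmul p X \<beta>0 j - Xmul p X \<beta>s j)"

text \<open>\<open>data_lr\<close> is the likelihood ratio of \<open>\<beta>0\<close> against \<open>\<beta>s\<close>. On the event that every column of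
  \<open>X\<close> has inner product at most \<open>lambar\<close> with the noise, \<open>data_lr * tilted_lr\<close> dominates the
  likelihood ratio of \<open>\<beta>\<close> against \<open>\<beta>s\<close>: the fraction \<open>lam / (2 * lambar)\<close> of the noise term has
  been traded for the penalty \<open>lam / 2 * l1on {..<p} (\<beta> - \<beta>s)\<close>.\<close>

definition data_lr :: "nat \<Rightarrow> nat \<Rightarrow> (nat \<Rightarrow> nat \<Rightarrow> real) \<Rightarrow> (nat \<Rightarrow> real) \<Rightarrow> (nat \<Rightarrow> real) \<Rightarrow> (nat \<Rightarrow> real) \<Rightarrow> real" where
  "data_lr n p X \<beta>0 \<beta>s Y = exp (dot n (bias p X \<beta>0 \<beta>s) (\<lambda>j. Y j - Xmul p X \<beta>0 j)
     + dot n (bias p X \<beta>0 \<beta>s) (bias p X \<beta>0 \<beta>s) / 2)"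

definition tilted_lr :: "nat \<Rightarrow> nat \<Rightarrow> (nat \<Rightarrow> nat \<Rightarrow> real) \<Rightarrow> real \<Rightarrow> (nat \<Rightarrow> real) \<Rightarrow> (nat \<Rightarrow> real) \<Rightarrow> (nat \<Rightarrow> real) \<Rightarrow> (nat \<Rightarrow> real) \<Rightarrow> real" where
  "tilted_lr n p X lam \<beta>0 \<beta>s Y \<beta> =
     (let \<delta> = bias p X \<beta>0 \<beta>s; d = (\<lambda>i. \<beta> i - \<beta>s i); r = lam / (2 * lambar n p X) in
      exp (dot n (\<lambda>j. (1 - r) * Xmul p X d j - \<delta> j) (\<lambda>j. Y j - Xmul p X \<beta>0 j)
        + (dot n \<delta> (Xmul p X d) - dot n (Xmul p X d) (Xmul p X d) / 2 - dot n \<delta> \<delta> / 2 + lam / 2 * l1on {..<p} d)))"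

text \<open>The bias terms in \<open>data_lr\<close> are taken out again by
  \<open>tilted_lr\<close>, so the claim reduces to r <noise, X d> \<le> \<open>lam / 2\<close>
  |d|_1, which is the duality of the l1 norm and the maximal column correlation.\<close>

lemma lik_le_tilted:
  assumes lb: "lambar n p X > 0" and lam: "lam > 0"
    and noise: "\<And>i. i < p \<Longrightarrow> \<bar>dot n (\<lambda>j. Y j - Xmul p X \<beta>0 j) (\<lambda>j. X j i)\<bar> \<le> lambar n p X"
  shows "lik n p X Y \<beta> \<le> lik n p X Y \<beta>s * (data_lr n p X \<beta>0 \<beta>s Y * tilted_lr n p X lam \<beta>0 \<beta>s Y \<beta>)"
proof -
  define \<delta> where "\<delta> = bias p X \<beta>0 \<beta>s"
  define d where "d = (\<lambda>i. \<beta> i - \<beta>s i)"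
  define r where "r = lam / (2 * lambar n p X)"
  define \<epsilon> where "\<epsilon> = (\<lambda>j. Y j - Xmul p X \<beta>0 j)"
  have W: "(\<lambda>j. Y j - Xmul p X \<beta>s j) = (\<lambda>j. \<epsilon> j + \<delta> j)"
    by (simp add: \<epsilon>_def \<delta>_def bias_def)
  have "\<bar>dot n \<epsilon> (Xmul p X d)\<bar> \<le> lambar n p X * l1on {..<p} d"
    using noise unfolding \<epsilon>_def by (rule abs_dot_Xmul_le)
  then have "r * dot n \<epsilon> (Xmul p X d) \<le> r * (lambar n p X * l1on {..<p} d)"
    using lb lam by (intro mult_left_mono) (auto simp: r_def)
  also have "\<dots> = lam / 2 * l1on {..<p} d" using lb by (simp add: r_def)
  finally have A: "r * dot n \<epsilon> (Xmul p X d) \<le> lam / 2 * l1on {..<p} d" .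
  have "lik n p X Y \<beta> = lik n p X Y \<beta>s * exp (dot n (\<lambda>j. \<epsilon> j + \<delta> j) (Xmul p X d) - dot n (Xmul p X d) (Xmul p X d) / 2)"
    using lik_shift[of n p X Y \<beta>s d] unfolding W by (simp add: d_def)
  also have "\<dots> \<le> lik n p X Y \<beta>s * exp (dot n \<delta> \<epsilon> + dot n \<delta> \<delta> / 2
     + (dot n (\<lambda>j. (1 - r) * Xmul p X d j - \<delta> j) \<epsilon>
        + (dot n \<delta> (Xmul p X d) - dot n (Xmul p X d) (Xmul p X d) / 2 - dot n \<delta> \<delta> / 2 + lam / 2 * l1on {..<p} d)))"
    using A lik_pos[of n p X Y \<beta>s]
    by (simp add: dot_simps dot_commute[of n "Xmul p X d" \<epsilon>] algebra_simps)
  finally show ?thesis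
    unfolding data_lr_def tilted_lr_def Let_def exp_add
    unfolding \<delta>_def[symmetric] d_def[symmetric] r_def[symmetric] \<epsilon>_def[symmetric]
    by (simp add: mult_ac)
qed

text \<open>With r = 0 and no penalty \<open>tilted_lr\<close> would be the likelihood ratio of
  \<beta> against \<open>\<beta>0\<close>, of mean one. Shrinking the noise term by 1 - r changes
  the log of the mean by -r q + r^2 q / 2 + r <\<delta>, X d>. Here r^2 \<le> r, and the cross term
  costs at most r q / 4 + r |\<delta>|^2, which leaves -r q / 4 and one copy of
  |\<delta>|^2.\<close>

lemma nn_integral_tilted_le:
  fixes \<beta>0 \<beta>s \<beta> :: "nat \<Rightarrow> real"
  assumes lb: "lambar n p X > 0" and lam: "lam > 0" and lam2: "lam \<le> 2 * lambar n p X"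
  defines "\<delta> \<equiv> bias p X \<beta>0 \<beta>s" and "d \<equiv> \<lambda>i::nat. \<beta> i - \<beta>s i"
  shows "(\<integral>\<^sup>+Y. ennreal (tilted_lr n p X lam \<beta>0 \<beta>s Y \<beta>) \<partial>data_measure n p X \<beta>0)
     \<le> ennreal (exp (lam / 2 * l1on {..<p} d - lam / (2 * lambar n p X) / 4 * dot n (Xmul p X d) (Xmul p X d) + dot n \<delta> \<delta>))"
proof -
  define r where "r = lam / (2 * lambar n p X)"
  have r: "0 \<le> r" "r \<le> 1" using lb lam lam2 by (auto simp: r_def)
  define q where "q = dot n (Xmul p X d) (Xmul p X d)"
  have q: "q \<ge> 0" unfolding q_def by (rule dot_self_nonneg)
  have D: "dot n \<delta> \<delta> \<ge> 0" by (rule dot_self_nonneg)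
  have "0 \<le> dot n (\<lambda>j. 1/2 * Xmul p X d j - \<delta> j) (\<lambda>j. 1/2 * Xmul p X d j - \<delta> j)"
    by (rule dot_self_nonneg)
  also have "\<dots> = q / 4 - dot n \<delta> (Xmul p X d) + dot n \<delta> \<delta>"
    unfolding dot_simps dot_commute[of n "Xmul p X d" \<delta>] q_def by (simp add: field_simps)
  finally have "r * dot n \<delta> (Xmul p X d) \<le> r * (q / 4 + dot n \<delta> \<delta>)"
    using r by (intro mult_left_mono) auto
  moreover have "r * dot n \<delta> \<delta> \<le> 1 * dot n \<delta> \<delta>" using r D by (intro mult_right_mono) auto
  moreover have "r\<^sup>2 * q \<le> r * q" using r q by (intro mult_right_mono) (auto simp: power2_eq_square mult_left_le)
  moreover have "dot n (\<lambda>j. (1 - r) * Xmul p X d j - \<delta> j) (\<lambda>j. (1 - r) * Xmul p X d j - \<delta> j)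
     = (1 - r)\<^sup>2 * q - 2 * (1 - r) * dot n \<delta> (Xmul p X d) + dot n \<delta> \<delta>"
    by (simp add: dot_simps dot_commute[of n "Xmul p X d" \<delta>] q_def power2_eq_square algebra_simps)
  ultimately have "dot n (\<lambda>j. (1 - r) * Xmul p X d j - \<delta> j) (\<lambda>j. (1 - r) * Xmul p X d j - \<delta> j) / 2
     + (dot n \<delta> (Xmul p X d) - q / 2 - dot n \<delta> \<delta> / 2 + lam / 2 * l1on {..<p} d)
     \<le> lam / 2 * l1on {..<p} d - r / 4 * q + dot n \<delta> \<delta>"
    by (simp add: power2_eq_square algebra_simps)
  then show ?thesis
    unfolding tilted_lr_def Let_def nn_integral_data_mgf
    unfolding \<delta>_def[symmetric] d_def[symmetric] r_def[symmetric] q_def[symmetric]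
    by (intro ennreal_leI) simp
qed

lemma measurable_tilted [measurable]:
  "(\<lambda>z. tilted_lr n p X lam \<beta>0 \<beta>s (fst z) (zero_ext S (snd z)))
     \<in> borel_measurable (data_measure n p X \<beta>0 \<Otimes>\<^sub>M laplace_PiM lam S)"
proof -
  let ?P = "data_measure n p X \<beta>0 \<Otimes>\<^sub>M laplace_PiM lam S"
  have z: "(\<lambda>z. zero_ext S (snd z) i) \<in> borel_measurable ?P" for i
    by (rule measurable_compose[OF measurable_snd measurable_zero_ext])
  have x[measurable]: "(\<lambda>z. Xmul p X (\<lambda>i. zero_ext S (snd z) i - \<beta>s i) j) \<in> borel_measurable ?P" for j
    unfolding Xmul_def using z by measurable
  have l[measurable]: "(\<lambda>z. l1on {..<p} (\<lambda>i. zero_ext S (snd z) i - \<beta>s i)) \<in> borel_measurable ?P"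
    unfolding l1on_def using z by measurable
  have [measurable]: "(\<lambda>z. dot n a (Xmul p X (\<lambda>i. zero_ext S (snd z) i - \<beta>s i))) \<in> borel_measurable ?P"
    "(\<lambda>z. dot n (Xmul p X (\<lambda>i. zero_ext S (snd z) i - \<beta>s i)) (Xmul p X (\<lambda>i. zero_ext S (snd z) i - \<beta>s i))) \<in> borel_measurable ?P" for a
    unfolding dot_def by measurable
  show ?thesis unfolding tilted_lr_def Let_def by measurable
qed

section \<open>Expected posterior mass of large models\<close>

text \<open>The cut is made on the size of the drawn model and not on an event for the coefficients,
  so this majorant is measurable in \<open>Y\<close> whatever the event is.\<close>

definition num_bound :: "nat \<Rightarrow> nat \<Rightarrow> (nat \<Rightarrow> nat \<Rightarrow> real) \<Rightarrow> real \<Rightarrow> (nat \<Rightarrow> real) \<Rightarrow> (nat \<Rightarrow> real) \<Rightarrow> (nat \<Rightarrow> real)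
    \<Rightarrow> real \<Rightarrow> (nat \<Rightarrow> real) \<Rightarrow> ennreal" where
  "num_bound n p X lam pis \<beta>0 \<beta>s thr Y = (\<Sum>s\<le>p. ennreal (pis s / real (p choose s)) *
     (\<Sum>S\<in>{S. S \<subseteq> {..<p} \<and> card S = s}.
        if thr < real s then \<integral>\<^sup>+x. ennreal (tilted_lr n p X lam \<beta>0 \<beta>s Y (zero_ext S x)) \<partial>laplace_PiM lam S else 0))"

lemma measurable_nn_integral_tilted:
  assumes "lam > 0" "finite S"
  shows "(\<lambda>Y. if b then \<integral>\<^sup>+x. ennreal (tilted_lr n p X lam \<beta>0 \<beta>s Y (zero_ext S x)) \<partial>laplace_PiM lam S else 0)
     \<in> borel_measurable (data_measure n p X \<beta>0)"
  using sigma_finite_measure.borel_measurable_nn_integral_fst[OF sigma_finite_laplace_PiM[OF assms],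
      of "\<lambda>z. ennreal (tilted_lr n p X lam \<beta>0 \<beta>s (fst z) (zero_ext S (snd z)))" "data_measure n p X \<beta>0"]
  by (cases b) simp_all

lemma measurable_num_bound:
  assumes "lam > 0"
  shows "num_bound n p X lam pis \<beta>0 \<beta>s thr \<in> borel_measurable (data_measure n p X \<beta>0)"
  unfolding num_bound_def
  by (intro borel_measurable_sum borel_measurable_times_ennreal borel_measurable_const)
     (auto intro!: measurable_nn_integral_tilted assms finite_subset[of _ "{..<p}"])

text \<open>Once Fubini has put the Gaussian expectation inside, the exponent left over is
  \<open>lam\<close> |\<beta>|_1 - \<open>lam / 4\<close> |d|_1 plus constants. It splits over the
  coordinates of \<open>S\<close>, and every coordinate integrates to at most 4.\<close>

lemma nn_integral_tilted_prior_le: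
  fixes \<beta>0 \<beta>s :: "nat \<Rightarrow> real"
  assumes C: "colnorm n p X > 0" and p: "p \<ge> 2" and lam: "lam > 0" "lam \<le> 2 * lambar n p X"
    and phi: "supp p \<beta>s = {} \<or> compat n p X (supp p \<beta>s) > 0"
    and S: "S \<subseteq> {..<p}"
  defines "D \<equiv> dot n (bias p X \<beta>0 \<beta>s) (bias p X \<beta>0 \<beta>s)"
    and "R \<equiv> 49 / 2 * (lam / lambar n p X) * real (card (supp p \<beta>s)) * ln (real p) / (compat n p X (supp p \<beta>s))\<^sup>2"
  shows "(\<integral>\<^sup>+Y. (\<integral>\<^sup>+x. ennreal (tilted_lr n p X lam \<beta>0 \<beta>s Y (zero_ext S x)) \<partial>laplace_PiM lam S) \<partial>data_measure n p X \<beta>0)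
    \<le> ennreal (exp (D + R - lam * l1on {..<p} \<beta>s) * 4 ^ card S)"
proof -
  have fin: "finite S" using S finite_subset by blast
  have lb: "lambar n p X > 0" using lam by simp
  interpret pair_sigma_finite "data_measure n p X \<beta>0" "laplace_PiM lam S"
    by (intro pair_sigma_finite.intro sigma_finite_data_measure sigma_finite_laplace_PiM lam fin)
  interpret product_sigma_finite "\<lambda>_::nat. laplace_measure lam"
    by (rule product_sigma_finite_laplace[OF lam(1)])
  let ?K = "exp (D + R - lam * l1on {..<p} \<beta>s)"
  let ?f = "\<lambda>i x. ennreal (exp (lam * \<bar>x\<bar> - lam / 4 * \<bar>x - \<beta>s i\<bar>))"
  have "(\<integral>\<^sup>+Y. (\<integral>\<^sup>+x. ennreal (tilted_lr n p X lam \<beta>0 \<beta>s Y (zero_ext S x)) \<partial>laplace_PiM lam S) \<partial>data_measure n p X \<beta>0)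
     = (\<integral>\<^sup>+x. (\<integral>\<^sup>+Y. ennreal (tilted_lr n p X lam \<beta>0 \<beta>s Y (zero_ext S x)) \<partial>data_measure n p X \<beta>0) \<partial>laplace_PiM lam S)"
    by (rule Fubini'[symmetric]) (simp add: case_prod_beta)
  also have "\<dots> \<le> (\<integral>\<^sup>+x. ennreal ?K * (\<Prod>i\<in>S. ?f i (x i)) \<partial>laplace_PiM lam S)"
  proof (rule nn_integral_mono)
    fix x :: "nat \<Rightarrow> real"
    define \<beta> where "\<beta> = zero_ext S x"
    define d where "d = (\<lambda>i. \<beta> i - \<beta>s i)"
    have l1: "l1on {..<p} \<beta> = (\<Sum>i\<in>S. \<bar>x i\<bar>)"
    proof -
      have "l1on {..<p} \<beta> = (\<Sum>i\<in>S. \<bar>\<beta> i\<bar>)"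
        unfolding l1on_def using S by (intro sum.mono_neutral_right) (auto simp: \<beta>_def zero_ext_def)
      then show ?thesis by (simp add: \<beta>_def zero_ext_def)
    qed
    have "(\<Sum>i\<in>S. \<bar>x i - \<beta>s i\<bar>) = (\<Sum>i\<in>S. \<bar>d i\<bar>)" by (simp add: d_def \<beta>_def zero_ext_def)
    also have "\<dots> \<le> l1on {..<p} d" unfolding l1on_def using S by (intro sum_mono2) auto
    \<comment> \<open>Coordinates of \<open>d\<close> outside \<open>S\<close> only help, and are
      dropped so that the bound factorises over \<open>S\<close>.\<close>
    finally have "lam / 4 * (\<Sum>i\<in>S. \<bar>x i - \<beta>s i\<bar>) \<le> lam / 4 * l1on {..<p} d"
      using lam by (intro mult_left_mono) auto
    then have "lam * l1on {..<p} \<beta> - lam / 4 * l1on {..<p} d \<le> (\<Sum>i\<in>S. lam * \<bar>x i\<bar> - lam / 4 * \<bar>x i - \<beta>s i\<bar>)"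
      unfolding l1 by (simp add: sum_subtractf sum_distrib_left)
    moreover note l1_exponent_bound[OF C p lam(1) phi, of \<beta>]
    ultimately have "lam / 2 * l1on {..<p} d - lam / (2 * lambar n p X) / 4 * dot n (Xmul p X d) (Xmul p X d) + D
      \<le> (D + R - lam * l1on {..<p} \<beta>s) + (\<Sum>i\<in>S. lam * \<bar>x i\<bar> - lam / 4 * \<bar>x i - \<beta>s i\<bar>)"
      unfolding R_def d_def by linarith
    then have "ennreal (exp (lam / 2 * l1on {..<p} d - lam / (2 * lambar n p X) / 4 * dot n (Xmul p X d) (Xmul p X d) + D))
      \<le> ennreal (exp ((D + R - lam * l1on {..<p} \<beta>s) + (\<Sum>i\<in>S. lam * \<bar>x i\<bar> - lam / 4 * \<bar>x i - \<beta>s i\<bar>)))"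
      by (intro ennreal_leI) simp
    also have "\<dots> = ennreal ?K * (\<Prod>i\<in>S. ?f i (x i))"
      by (simp add: exp_add exp_sum fin prod_ennreal ennreal_mult[symmetric] prod_nonneg)
    finally show "(\<integral>\<^sup>+Y. ennreal (tilted_lr n p X lam \<beta>0 \<beta>s Y (zero_ext S x)) \<partial>data_measure n p X \<beta>0)
       \<le> ennreal ?K * (\<Prod>i\<in>S. ?f i (x i))"
      using nn_integral_tilted_le[OF lb lam, of \<beta>0 \<beta>s \<beta>] unfolding D_def d_def \<beta>_def by (rule order_trans[rotated])
  qed
  also have "\<dots> = ennreal ?K * (\<integral>\<^sup>+x. (\<Prod>i\<in>S. ?f i (x i)) \<partial>laplace_PiM lam S)"
    by (rule nn_integral_cmult) measurable
  also have "\<dots> = ennreal ?K * (\<Prod>i\<in>S. \<integral>\<^sup>+x. ?f i x \<partial>laplace_measure lam)"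
    by (subst product_nn_integral_prod) (auto simp: fin)
  also have "\<dots> \<le> ennreal ?K * (\<Prod>i\<in>S. 4)"
    by (intro mult_left_mono prod_mono_ennreal nn_integral_laplace_tilt_le lam) auto
  also have "\<dots> = ennreal (?K * 4 ^ card S)"
    by (simp add: ennreal_mult ennreal_power[symmetric])
  finally show ?thesis .
qed

text \<open>The bound for a single model depends on its size alone, so the number of models of size
  s cancels the uniform weight 1 / \<open>(p choose s)\<close>.\<close>

lemma nn_integral_num_bound_le:
  fixes \<beta>0 \<beta>s :: "nat \<Rightarrow> real"
  assumes C: "colnorm n p X > 0" and p: "p \<ge> 2" and lam: "lam > 0" "lam \<le> 2 * lambar n p X"
    and phi: "supp p \<beta>s = {} \<or> compat n p X (supp p \<beta>s) > 0"
    and pis: "\<And>s. s \<le> p \<Longrightarrow> pis s \<ge> 0"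
  defines "D \<equiv> dot n (bias p X \<beta>0 \<beta>s) (bias p X \<beta>0 \<beta>s)"
    and "R \<equiv> 49 / 2 * (lam / lambar n p X) * real (card (supp p \<beta>s)) * ln (real p) / (compat n p X (supp p \<beta>s))\<^sup>2"
  shows "(\<integral>\<^sup>+Y. num_bound n p X lam pis \<beta>0 \<beta>s thr Y \<partial>data_measure n p X \<beta>0)
    \<le> ennreal (exp (D + R - lam * l1on {..<p} \<beta>s) * (\<Sum>s | s \<le> p \<and> thr < real s. pis s * 4 ^ s))"
proof -
  let ?K = "exp (D + R - lam * l1on {..<p} \<beta>s)"
  let ?g = "\<lambda>s S Y. if thr < real s then \<integral>\<^sup>+x. ennreal (tilted_lr n p X lam \<beta>0 \<beta>s Y (zero_ext S x)) \<partial>laplace_PiM lam S else 0"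
  let ?F = "\<lambda>s. {S. S \<subseteq> {..<p} \<and> card S = s}"
  have meas: "?g s S \<in> borel_measurable (data_measure n p X \<beta>0)" if "S \<in> ?F s" for s S
    using that by (auto intro!: measurable_nn_integral_tilted lam finite_subset[of _ "{..<p}"])
  have "(\<integral>\<^sup>+Y. num_bound n p X lam pis \<beta>0 \<beta>s thr Y \<partial>data_measure n p X \<beta>0)
     = (\<Sum>s\<le>p. \<integral>\<^sup>+Y. ennreal (pis s / real (p choose s)) * (\<Sum>S\<in>?F s. ?g s S Y) \<partial>data_measure n p X \<beta>0)"
    unfolding num_bound_def
    by (rule nn_integral_sum)
       (intro borel_measurable_sum borel_measurable_times_ennreal borel_measurable_const meas)
  also have "\<dots> = (\<Sum>s\<le>p. ennreal (pis s / real (p choose s)) * (\<Sum>S\<in>?F s. \<integral>\<^sup>+Y. ?g s S Y \<partial>data_measure n p X \<beta>0))"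
  proof (rule sum.cong[OF refl])
    fix s
    have "(\<lambda>Y. \<Sum>S\<in>?F s. ?g s S Y) \<in> borel_measurable (data_measure n p X \<beta>0)"
      by (intro borel_measurable_sum meas)
    then have "(\<integral>\<^sup>+Y. ennreal (pis s / real (p choose s)) * (\<Sum>S\<in>?F s. ?g s S Y) \<partial>data_measure n p X \<beta>0)
       = ennreal (pis s / real (p choose s)) * (\<integral>\<^sup>+Y. (\<Sum>S\<in>?F s. ?g s S Y) \<partial>data_measure n p X \<beta>0)"
      by (rule nn_integral_cmult)
    also have "(\<integral>\<^sup>+Y. (\<Sum>S\<in>?F s. ?g s S Y) \<partial>data_measure n p X \<beta>0)
       = (\<Sum>S\<in>?F s. \<integral>\<^sup>+Y. ?g s S Y \<partial>data_measure n p X \<beta>0)"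
      by (rule nn_integral_sum) (rule meas)
    finally show "(\<integral>\<^sup>+Y. ennreal (pis s / real (p choose s)) * (\<Sum>S\<in>?F s. ?g s S Y) \<partial>data_measure n p X \<beta>0)
       = ennreal (pis s / real (p choose s)) * (\<Sum>S\<in>?F s. \<integral>\<^sup>+Y. ?g s S Y \<partial>data_measure n p X \<beta>0)" .
  qed
  also have "\<dots> \<le> (\<Sum>s\<le>p. ennreal (if thr < real s then ?K * (pis s * 4 ^ s) else 0))"
  proof (rule sum_mono)
    fix s assume s: "s \<in> {..p}"
    have ch: "real (p choose s) > 0" using s by (simp add: zero_less_binomial_iff)
    have "(\<Sum>S\<in>?F s. \<integral>\<^sup>+Y. ?g s S Y \<partial>data_measure n p X \<beta>0)
       \<le> (\<Sum>S\<in>?F s. ennreal (if thr < real s then ?K * 4 ^ s else 0))"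
    proof (rule sum_mono)
      fix S assume "S \<in> ?F s"
      then show "(\<integral>\<^sup>+Y. ?g s S Y \<partial>data_measure n p X \<beta>0) \<le> ennreal (if thr < real s then ?K * 4 ^ s else 0)"
        using nn_integral_tilted_prior_le[OF C p lam phi, of S \<beta>0] by (auto simp: D_def R_def)
    qed
    also have "\<dots> = ennreal (real (p choose s) * (if thr < real s then ?K * 4 ^ s else 0))"
      using n_subsets[of "{..<p}" s] by (simp add: ennreal_mult ennreal_of_nat_eq_real_of_nat)
    finally have "ennreal (pis s / real (p choose s)) * (\<Sum>S\<in>?F s. \<integral>\<^sup>+Y. ?g s S Y \<partial>data_measure n p X \<beta>0)
      \<le> ennreal (pis s / real (p choose s)) * ennreal (real (p choose s) * (if thr < real s then ?K * 4 ^ s else 0))"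
      by (rule mult_left_mono) simp
    also have "\<dots> = ennreal (if thr < real s then ?K * (pis s * 4 ^ s) else 0)"
      using ch pis[of s] s by (auto simp: ennreal_mult[symmetric] mult_ac)
    finally show "ennreal (pis s / real (p choose s)) * (\<Sum>S\<in>?F s. \<integral>\<^sup>+Y. ?g s S Y \<partial>data_measure n p X \<beta>0)
      \<le> ennreal (if thr < real s then ?K * (pis s * 4 ^ s) else 0)" .
  qed
  also have "\<dots> = ennreal (\<Sum>s\<le>p. if thr < real s then ?K * (pis s * 4 ^ s) else 0)"
    using pis by (intro sum_ennreal) auto
  also have "(\<Sum>s\<le>p. if thr < real s then ?K * (pis s * 4 ^ s) else 0) = ?K * (\<Sum>s | s \<le> p \<and> thr < real s. pis s * 4 ^ s)"
    unfolding sum_distrib_left by (rule sum.mono_neutral_cong_right) auto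
  finally show ?thesis .
qed

section \<open>From numerator and evidence to the posterior mass\<close>

lemma posterior_le_1: "posterior n p X lam pis B Y \<le> 1"
proof -
  let ?N = "prior_nn p lam pis (\<lambda>\<beta>. indicator B \<beta> * ennreal (lik n p X Y \<beta>))"
  let ?D = "prior_nn p lam pis (\<lambda>\<beta>. ennreal (lik n p X Y \<beta>))"
  have le: "?N \<le> ?D" unfolding prior_nn_def
    by (intro sum_mono mult_left_mono nn_integral_mono) (auto simp: indicator_def)
  show ?thesis
  proof (cases "?D = 0")
    \<comment> \<open>A vanishing evidence forces a vanishing numerator, and 0 / 0 is 0 in
      \<open>ennreal\<close>.\<close>
    case True
    then have "?N = 0" using le by simp
    then show ?thesis by (simp add: posterior_def)
  next
    case False
    then show ?thesis unfolding posterior_def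
      by (intro divide_le_posI_ennreal) (use le in \<open>auto simp: zero_less_iff_neq_zero\<close>)
  qed
qed

text \<open>A draw from a model \<open>S\<close> has at most \<open>card S\<close> nonzero
  coordinates, so models of size at most \<open>thr\<close> contribute nothing to the event; on the
  others the likelihood is replaced by its tilted majorant.\<close>

lemma numerator_le_num_bound:
  assumes lb: "lambar n p X > 0" and lam: "lam > 0"
    and noise: "\<And>i. i < p \<Longrightarrow> \<bar>dot n (\<lambda>j. Y j - Xmul p X \<beta>0 j) (\<lambda>j. X j i)\<bar> \<le> lambar n p X"
    and B: "\<And>\<beta>. \<beta> \<in> B \<Longrightarrow> thr < real (card (supp p \<beta>))"
    and Y: "Y \<in> space (data_measure n p X \<beta>0)"
  shows "prior_nn p lam pis (\<lambda>\<beta>. indicator B \<beta> * ennreal (lik n p X Y \<beta>))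
    \<le> ennreal (lik n p X Y \<beta>s * data_lr n p X \<beta>0 \<beta>s Y) * num_bound n p X lam pis \<beta>0 \<beta>s thr Y"
proof -
  let ?k = "lik n p X Y \<beta>s * data_lr n p X \<beta>0 \<beta>s Y"
  have k: "?k \<ge> 0" by (simp add: lik_pos less_imp_le data_lr_def)
  have one: "(\<integral>\<^sup>+x. indicator B (zero_ext S x) * ennreal (lik n p X Y (zero_ext S x)) \<partial>laplace_PiM lam S)
     \<le> ennreal ?k * (if thr < real s then \<integral>\<^sup>+x. ennreal (tilted_lr n p X lam \<beta>0 \<beta>s Y (zero_ext S x)) \<partial>laplace_PiM lam S else 0)"
    if S: "S \<subseteq> {..<p}" "card S = s" for S s
  proof (cases "thr < real s")
    case True
    have meas: "(\<lambda>x. ennreal (tilted_lr n p X lam \<beta>0 \<beta>s Y (zero_ext S x))) \<in> borel_measurable (laplace_PiM lam S)"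
      using measurable_compose[OF measurable_Pair1'[OF Y] 
        measurable_tilted[where n = n and p = p and X = X and lam = lam and ?\<beta>0.0 = \<beta>0 and \<beta>s = \<beta>s and S = S]]
      by simp
    have "(\<integral>\<^sup>+x. indicator B (zero_ext S x) * ennreal (lik n p X Y (zero_ext S x)) \<partial>laplace_PiM lam S)
      \<le> (\<integral>\<^sup>+x. ennreal ?k * ennreal (tilted_lr n p X lam \<beta>0 \<beta>s Y (zero_ext S x)) \<partial>laplace_PiM lam S)"
    proof (rule nn_integral_mono)
      fix x
      have "indicator B (zero_ext S x) * ennreal (lik n p X Y (zero_ext S x)) \<le> ennreal (lik n p X Y (zero_ext S x))"
        by (auto simp: indicator_def)
      also have "\<dots> \<le> ennreal (?k * tilted_lr n p X lam \<beta>0 \<beta>s Y (zero_ext S x))"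
        using lik_le_tilted[OF lb lam noise, of "zero_ext S x" \<beta>s]
        by (intro ennreal_leI) (simp add: mult.assoc)
      also have "\<dots> = ennreal ?k * ennreal (tilted_lr n p X lam \<beta>0 \<beta>s Y (zero_ext S x))"
        using k by (rule ennreal_mult) (simp add: tilted_lr_def Let_def)
      finally show "indicator B (zero_ext S x) * ennreal (lik n p X Y (zero_ext S x))
         \<le> ennreal ?k * ennreal (tilted_lr n p X lam \<beta>0 \<beta>s Y (zero_ext S x))" .
    qed
    also have "\<dots> = ennreal ?k * (\<integral>\<^sup>+x. ennreal (tilted_lr n p X lam \<beta>0 \<beta>s Y (zero_ext S x)) \<partial>laplace_PiM lam S)"
      by (rule nn_integral_cmult[OF meas])
    finally show ?thesis using True by simp
  next
    case False
    have "zero_ext S x \<notin> B" for x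
    proof
      assume "zero_ext S x \<in> B"
      then have "thr < real (card (supp p (zero_ext S x)))" by (rule B)
      also have "card (supp p (zero_ext S x)) \<le> card S"
        by (intro card_mono finite_subset[OF S(1)]) (auto simp: supp_def zero_ext_def)
      finally show False using False S by simp
    qed
    then show ?thesis by simp
  qed
  have "prior_nn p lam pis (\<lambda>\<beta>. indicator B \<beta> * ennreal (lik n p X Y \<beta>))
    \<le> (\<Sum>s\<le>p. ennreal (pis s / real (p choose s)) * (\<Sum>S\<in>{S. S \<subseteq> {..<p} \<and> card S = s}.
        ennreal ?k * (if thr < real s then \<integral>\<^sup>+x. ennreal (tilted_lr n p X lam \<beta>0 \<beta>s Y (zero_ext S x)) \<partial>laplace_PiM lam S else 0)))"
    unfolding prior_nn_def
  proof (rule sum_mono, rule mult_left_mono, rule sum_mono)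
    fix s S assume "S \<in> {S. S \<subseteq> {..<p} \<and> card S = s}"
    then have "S \<subseteq> {..<p}" "card S = s" by blast+
    then show "(\<integral>\<^sup>+x. indicator B (zero_ext S x) * ennreal (lik n p X Y (zero_ext S x)) \<partial>laplace_PiM lam S)
      \<le> ennreal ?k * (if thr < real s then \<integral>\<^sup>+x. ennreal (tilted_lr n p X lam \<beta>0 \<beta>s Y (zero_ext S x)) \<partial>laplace_PiM lam S else 0)"
      by (rule one)
  qed (rule zero_le)
  also have "\<dots> = ennreal ?k * num_bound n p X lam pis \<beta>0 \<beta>s thr Y"
    unfolding num_bound_def sum_distrib_left by (intro sum.cong refl mult.left_commute)
  finally show ?thesis .
qed

text \<open>Changing measure from \<open>\<beta>0\<close> to \<open>\<beta>s\<close> by the Cauchy-Schwarz inequality is replaced by the pointwise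
  bound \<open>min 1 (L * H) \<le> c * L + H / c\<close>, to be used with an optimal constant \<open>c\<close>.\<close>

lemma nn_integral_posterior_le:
  fixes \<beta>0 \<beta>s :: "nat \<Rightarrow> real"
  assumes C: "colnorm n p X > 0" "colnorm n p X / real p \<le> lam" and p: "p \<ge> 2"
    and lam: "lam > 0" "lam \<le> 2 * lambar n p X"
    and phi: "supp p \<beta>s = {} \<or> compat n p X (supp p \<beta>s) > 0"
    and pis: "\<And>s. s \<le> p \<Longrightarrow> pis s > 0"
    and B: "\<And>\<beta>. \<beta> \<in> B \<Longrightarrow> thr < real (card (supp p \<beta>))"
    and c: "c > 0"
  defines "D \<equiv> dot n (bias p X \<beta>0 \<beta>s) (bias p X \<beta>0 \<beta>s)"
    and "R \<equiv> 49 / 2 * (lam / lambar n p X) * real (card (supp p \<beta>s)) * ln (real p) / (compat n p X (supp p \<beta>s))\<^sup>2"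
    and "s \<equiv> card (supp p \<beta>s)"
  shows "(\<integral>\<^sup>+Y. posterior n p X lam pis B Y \<partial>data_measure n p X \<beta>0)
    \<le> ennreal (2 / real p + c * exp D + 1 / c * (exp (1 / 2) * (real p * exp 1) ^ (2 * s) * exp (D + R)
          * (\<Sum>s' | s' \<le> p \<and> thr < real s'. pis s' * 4 ^ s') / pis s))"
proof -
  have lb: "lambar n p X > 0" using lam by simp
  have "s \<le> p" using card_mono[of "{..<p}" "supp p \<beta>s"] by (auto simp: s_def supp_def)
  then have ps: "pis s > 0" by (rule pis)
  \<comment> \<open>The lower bound for the evidence, relative to the likelihood of
    \<open>\<beta>s\<close>.\<close>
  define \<kappa> where "\<kappa> = exp (- lam * l1on {..<p} \<beta>s) * exp (- 1 / 2) * pis s / (real p * exp 1) ^ (2 * s)"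
  have \<kappa>: "\<kappa> > 0" unfolding \<kappa>_def using ps p by simp
  let ?L = "data_lr n p X \<beta>0 \<beta>s"
  let ?H = "num_bound n p X lam pis \<beta>0 \<beta>s thr"
  note mH = measurable_num_bound[OF lam(1), of n p X pis \<beta>0 \<beta>s thr]
  have L0: "?L Y > 0" for Y by (simp add: data_lr_def)
  have post: "posterior n p X lam pis B Y \<le> noise_tail n p X \<beta>0 Y + (ennreal c * ennreal (?L Y) + ennreal (1 / (c * \<kappa>)) * ?H Y)"
    if Y: "Y \<in> space (data_measure n p X \<beta>0)" for Y
  proof (cases "\<exists>i<p. \<bar>dot n (\<lambda>j. Y j - Xmul p X \<beta>0 j) (\<lambda>j. X j i)\<bar> > lambar n p X")
    case True
    then have "1 \<le> noise_tail n p X \<beta>0 Y" using noise_tail_ge_1[OF C(1) p] by blast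
    then show ?thesis using posterior_le_1 order_trans by (metis add_increasing2 zero_le)
  next
    case False
    then have noise: "\<And>i. i < p \<Longrightarrow> \<bar>dot n (\<lambda>j. Y j - Xmul p X \<beta>0 j) (\<lambda>j. X j i)\<bar> \<le> lambar n p X"
      by (meson linorder_not_less)
    have num: "prior_nn p lam pis (\<lambda>\<beta>. indicator B \<beta> * ennreal (lik n p X Y \<beta>)) \<le> ennreal (lik n p X Y \<beta>s * ?L Y) * ?H Y"
      by (rule numerator_le_num_bound[OF lb lam(1) noise B Y])
    have den: "ennreal (lik n p X Y \<beta>s * \<kappa>) \<le> prior_nn p lam pis (\<lambda>\<beta>. ennreal (lik n p X Y \<beta>))"
      using prior_nn_lik_ge[of lam p n X pis Y \<beta>s] lam p C pis unfolding \<kappa>_def s_def by (simp add: less_imp_le)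
    have "posterior n p X lam pis B Y \<le> ennreal (?L Y / \<kappa>) * ?H Y"
      unfolding posterior_def
    proof (rule divide_le_posI_ennreal)
      show "0 < prior_nn p lam pis (\<lambda>\<beta>. ennreal (lik n p X Y \<beta>))"
        using den \<kappa> lik_pos[of n p X Y \<beta>s] by (intro less_le_trans[OF _ den]) simp
      have "ennreal (lik n p X Y \<beta>s * ?L Y) * ?H Y = ennreal (lik n p X Y \<beta>s * \<kappa>) * (ennreal (?L Y / \<kappa>) * ?H Y)"
        using \<kappa> L0[of Y] lik_pos[of n p X Y \<beta>s]
        by (simp add: mult.assoc[symmetric] ennreal_mult[symmetric] less_imp_le)
      also have "\<dots> \<le> prior_nn p lam pis (\<lambda>\<beta>. ennreal (lik n p X Y \<beta>)) * (ennreal (?L Y / \<kappa>) * ?H Y)"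
        by (intro mult_right_mono den) simp
      finally show "prior_nn p lam pis (\<lambda>\<beta>. indicator B \<beta> * ennreal (lik n p X Y \<beta>))
        \<le> prior_nn p lam pis (\<lambda>\<beta>. ennreal (lik n p X Y \<beta>)) * (ennreal (?L Y / \<kappa>) * ?H Y)"
        using num by (rule order_trans[rotated])
    qed
    also have "\<dots> = ennreal c * ennreal (?L Y) * (ennreal (1 / (c * \<kappa>)) * ?H Y)"
      using \<kappa> L0[of Y] c by (simp add: mult.assoc[symmetric] ennreal_mult[symmetric] less_imp_le)
    finally have le: "posterior n p X lam pis B Y \<le> ennreal c * ennreal (?L Y) * (ennreal (1 / (c * \<kappa>)) * ?H Y)" .
    have "posterior n p X lam pis B Y \<le> ennreal c * ennreal (?L Y) + ennreal (1 / (c * \<kappa>)) * ?H Y"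
    \<comment> \<open>If this factor is at most 1, the product is at most the other factor;
      otherwise it already exceeds the posterior mass, which is at most 1.\<close>
    proof (cases "ennreal (1 / (c * \<kappa>)) * ?H Y \<le> 1")
      case True
      have "posterior n p X lam pis B Y \<le> ennreal c * ennreal (?L Y) * 1"
        by (rule order_trans[OF le mult_left_mono[OF True]]) simp
      then show ?thesis by (simp add: add_increasing2)
    next
      case False
      then have "1 \<le> ennreal (1 / (c * \<kappa>)) * ?H Y" by simp
      then show ?thesis using posterior_le_1 order_trans by (metis add_increasing zero_le)
    qed
    then show ?thesis by (simp add: add_increasing)
  qed
  have [measurable]: "?L \<in> borel_measurable (data_measure n p X \<beta>0)" unfolding data_lr_def by measurable
  have "(\<integral>\<^sup>+Y. posterior n p X lam pis B Y \<partial>data_measure n p X \<beta>0)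
     \<le> (\<integral>\<^sup>+Y. noise_tail n p X \<beta>0 Y + (ennreal c * ennreal (?L Y) + ennreal (1 / (c * \<kappa>)) * ?H Y) \<partial>data_measure n p X \<beta>0)"
    by (rule nn_integral_mono) (rule post)
  also have "\<dots> = (\<integral>\<^sup>+Y. noise_tail n p X \<beta>0 Y \<partial>data_measure n p X \<beta>0)
      + (ennreal c * (\<integral>\<^sup>+Y. ennreal (?L Y) \<partial>data_measure n p X \<beta>0)
      + ennreal (1 / (c * \<kappa>)) * (\<integral>\<^sup>+Y. ?H Y \<partial>data_measure n p X \<beta>0))"
    using mH by (simp add: nn_integral_add nn_integral_cmult)
  also have "\<dots> \<le> ennreal (2 / real p) + (ennreal c * ennreal (exp D)
      + ennreal (1 / (c * \<kappa>)) * ennreal (exp (D + R - lam * l1on {..<p} \<beta>s) * (\<Sum>s' | s' \<le> p \<and> thr < real s'. pis s' * 4 ^ s')))"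
  proof (intro add_mono mult_left_mono)
    show "(\<integral>\<^sup>+Y. ennreal (?L Y) \<partial>data_measure n p X \<beta>0) \<le> ennreal (exp D)"
      unfolding data_lr_def nn_integral_data_mgf D_def by simp
    show "(\<integral>\<^sup>+Y. ?H Y \<partial>data_measure n p X \<beta>0)
       \<le> ennreal (exp (D + R - lam * l1on {..<p} \<beta>s) * (\<Sum>s' | s' \<le> p \<and> thr < real s'. pis s' * 4 ^ s'))"
      unfolding D_def R_def
      by (rule nn_integral_num_bound_le[OF C(1) p lam phi]) (use pis in \<open>auto intro: less_imp_le\<close>)
  qed (auto intro: nn_integral_noise_tail_le C p)
  also have "\<dots> = ennreal (2 / real p + (c * exp D
      + 1 / (c * \<kappa>) * (exp (D + R - lam * l1on {..<p} \<beta>s) * (\<Sum>s' | s' \<le> p \<and> thr < real s'. pis s' * 4 ^ s'))))"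
  proof -
    have "(\<Sum>s' | s' \<le> p \<and> thr < real s'. pis s' * 4 ^ s') \<ge> 0"
      using pis by (intro sum_nonneg) (auto intro: less_imp_le)
    then show ?thesis using c \<kappa> by (simp add: ennreal_mult[symmetric] ennreal_plus[symmetric] del: ennreal_plus)
  qed
  \<comment> \<open>Here the two factors with \<open>l1on {..<p} \<beta>s\<close> cancel.\<close>
  also have "1 / (c * \<kappa>) * (exp (D + R - lam * l1on {..<p} \<beta>s) * (\<Sum>s' | s' \<le> p \<and> thr < real s'. pis s' * 4 ^ s'))
    = 1 / c * (exp (1 / 2) * (real p * exp 1) ^ (2 * s) * exp (D + R)
          * (\<Sum>s' | s' \<le> p \<and> thr < real s'. pis s' * 4 ^ s') / pis s)"
    using c ps p unfolding \<kappa>_def exp_diff by (simp add: exp_minus field_simps)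
  finally show ?thesis by (simp add: add.assoc)
qed

section \<open>Asymptotics\<close>

lemma prior_weight_le:
  fixes pis :: "nat \<Rightarrow> real"
  assumes "a \<ge> 0" "\<And>s. s \<in> {1..p} \<Longrightarrow> pis s \<le> a * pis (s - 1)" "s + m \<le> p"
  shows "pis (s + m) \<le> a ^ m * pis s"
  using assms(3)
proof (induction m)
  case (Suc m)
  have "pis (s + Suc m) \<le> a * pis (s + m)" using assms(2)[of "s + Suc m"] Suc.prems by simp
  also have "\<dots> \<le> a * (a ^ m * pis s)" using Suc assms(1) by (intro mult_left_mono) auto
  finally show ?case by simp
qed simp

text \<open>A zero at size 0 would spread to all sizes through the upper ratio, against total mass
  1; the lower ratio then carries positivity upwards. This allows division by the prior weight of
  the true size.\<close>

lemma prior_weight_pos: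
  fixes pis :: "nat \<Rightarrow> real"
  assumes nn: "\<And>s. s \<le> p \<Longrightarrow> pis s \<ge> 0" and sum: "(\<Sum>s\<le>p. pis s) = 1" and "a \<ge> 0" "b > 0"
    and up: "\<And>s. s \<in> {1..p} \<Longrightarrow> pis s \<le> a * pis (s - 1)"
    and low: "\<And>s. s \<in> {1..p} \<Longrightarrow> b * pis (s - 1) \<le> pis s"
    and "s \<le> p"
  shows "pis s > 0"
  using \<open>s \<le> p\<close>
proof (induction s)
  case 0
  show ?case
  proof (rule ccontr)
    assume "\<not> ?thesis"
    then have 0: "pis 0 = 0" using nn[of 0] by simp
    have "pis s = 0" if "s \<le> p" for s
      using prior_weight_le[where pis = pis and a = a and p = p and s = 0 and m = s, OF assms(3) up] nn[of s] that 0 by simp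
    then have "(\<Sum>s\<le>p. pis s) = 0" by (intro sum.neutral) auto
    with sum show False by simp
  qed
next
  case (Suc s)
  then have "0 < b * pis s" using \<open>b > 0\<close> by simp
  also have "\<dots> \<le> pis (Suc s)" using low[of "Suc s"] Suc.prems by simp
  finally show ?case .
qed

text \<open>The ratio per extra coordinate, \<open>4 * a\<close>, is split into 1/2 and
  \<open>b\<close>: the powers of 1/2 form a geometric series of sum at most 1, because J \<ge> 0
  makes every exponent at least 1, and the powers of \<open>b\<close> supply the decay
  \<open>K\<close>.\<close>

lemma sum_prior_tail_le:
  fixes pis :: "nat \<Rightarrow> real"
  assumes nn: "pis s \<ge> 0" and a: "a \<ge> 0" and up: "\<And>s. s \<in> {1..p} \<Longrightarrow> pis s \<le> a * pis (s - 1)"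
    and ab: "4 * a \<le> 1 / 2 * b" and J: "J \<ge> 0"
    and K: "\<And>m. m \<ge> 1 \<Longrightarrow> J < real m \<Longrightarrow> b ^ m \<le> K"
  shows "(\<Sum>s' | s' \<le> p \<and> real s + J < real s'. pis s' * 4 ^ s') \<le> pis s * 4 ^ s * K"
proof -
  let ?T = "{s'. s' \<le> p \<and> real s + J < real s'}"
  have b: "b \<ge> 0" using a ab by simp
  have each: "pis s' * 4 ^ s' \<le> pis s * 4 ^ s * K * (1 / 2) ^ (s' - s)" if "s' \<in> ?T" for s'
  proof -
    define m where "m = s' - s"
    have m: "s' = s + m" "m \<ge> 1" "J < real m" using that J by (auto simp: m_def)
    have "pis s' * 4 ^ s' \<le> a ^ m * pis s * 4 ^ s'"
      using prior_weight_le[where pis = pis and a = a and p = p and s = s and m = m, OF a up] that m by (intro mult_right_mono) auto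
    also have "\<dots> = pis s * 4 ^ s * (4 * a) ^ m" by (simp add: m(1) power_add power_mult_distrib)
    also have "\<dots> \<le> pis s * 4 ^ s * (1 / 2 * b) ^ m"
      using ab a nn by (intro mult_left_mono power_mono) auto
    also have "\<dots> = pis s * 4 ^ s * b ^ m * (1 / 2) ^ m" by (simp only: power_mult_distrib mult_ac)
    also have "\<dots> \<le> pis s * 4 ^ s * K * (1 / 2) ^ m"
      using K[OF m(2,3)] nn by (intro mult_right_mono mult_left_mono) auto
    finally show ?thesis by (simp add: m_def)
  qed
  \<comment> \<open>Nonnegativity of \<open>K\<close> comes from one admissible exponent.\<close>
  have "J < real (nat \<lceil>J\<rceil> + 1)" by linarith
  then have "b ^ (nat \<lceil>J\<rceil> + 1) \<le> K" by (rule K[rotated]) simp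
  then have K0: "K \<ge> 0" using b by (meson order_trans zero_le_power)
  have geom: "(\<Sum>s'\<in>?T. (1 / 2 :: real) ^ (s' - s)) \<le> 1"
  proof -
    have inj: "inj_on (\<lambda>s'. s' - s) ?T" using J by (intro inj_onI) auto
    have "(\<Sum>s'\<in>?T. (1 / 2 :: real) ^ (s' - s)) = (\<Sum>m\<in>(\<lambda>s'. s' - s) ` ?T. (1 / 2) ^ m)"
      by (simp add: sum.reindex[OF inj])
    also have "\<dots> \<le> (\<Sum>m\<in>{1..p}. (1 / 2) ^ m)"
      using J by (intro sum_mono2) auto
    also have "\<dots> = 1 - (1 / 2) ^ p" by (induction p) auto
    also have "\<dots> \<le> 1" by simp
    finally show ?thesis .
  qed
  have "(\<Sum>s'\<in>?T. pis s' * 4 ^ s') \<le> (\<Sum>s'\<in>?T. pis s * 4 ^ s * K * (1 / 2) ^ (s' - s))"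
    by (rule sum_mono) (rule each)
  also have "\<dots> = pis s * 4 ^ s * K * (\<Sum>s'\<in>?T. (1 / 2) ^ (s' - s))" by (rule sum_distrib_left[symmetric])
  also have "\<dots> \<le> pis s * 4 ^ s * K"
    using mult_left_mono[OF geom, of "pis s * 4 ^ s * K"] K0 nn by simp
  finally show ?thesis .
qed

text \<open>\<open>\<theta>\<close> makes M (1 - 2 \<theta>) = (M + 2) / 2, halfway between 2 and M.
  Of the resulting gain, 2 s ln P cancels P^(2 s), the surplus (M - 2) / 2 s ln P \<ge> 4 s covers
  e^(2 s) 4^s, 32 g covers 49/2 g, and 2 D turns exp D into exp (- D). The spare power P^(- A4
  \<theta>) is left untouched.\<close>

lemma exponent_balance:
  fixes P A4 M D \<kappa> \<psi> :: real and s :: nat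
  assumes P: "P \<ge> 2" and A4: "A4 > 0" and M: "M > 2" and big: "ln P * (M - 2) / 2 \<ge> 4"
    and D: "D \<ge> 0" and k: "\<kappa> \<ge> 0" and psi: "\<psi> \<ge> 0"
  defines "J \<equiv> M / A4 * (1 + 16 / \<psi> * \<kappa>) * real s + M / A4 * D / ln P"
    and "\<theta> \<equiv> (M - 2) / (4 * M)"
  shows "exp (1 / 2) * (P * exp 1) ^ (2 * s) * exp (D + 49 / 2 * \<kappa> * real s * ln P / \<psi>)
      * (4 ^ s * P powr (- (A4 * (1 - 2 * \<theta>) * J) - A4 * \<theta>))
    \<le> exp (- D) * (exp (1 / 2) * P powr (- (A4 * \<theta>)))"
proof -
  define g where "g = \<kappa> * real s * ln P / \<psi>"
  have lnP: "ln P > 0" using P by simp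
  have g: "g \<ge> 0" unfolding g_def using k psi lnP by simp
  have theta: "M * (1 - 2 * \<theta>) = (M + 2) / 2" using M by (simp add: \<theta>_def field_simps)
  have "A4 * (1 - 2 * \<theta>) * J * ln P = M * (1 - 2 * \<theta>) * ((1 + 16 / \<psi> * \<kappa>) * real s * ln P + D)"
    unfolding J_def using A4 lnP by (simp add: field_simps)
  also have "(1 + 16 / \<psi> * \<kappa>) * real s * ln P = real s * ln P + 16 * g"
    by (simp add: g_def algebra_simps)
  finally have AJ: "A4 * (1 - 2 * \<theta>) * J * ln P = (M + 2) / 2 * (real s * ln P + 16 * g + D)"
    unfolding theta .
  have ln4: "ln 4 \<le> (2::real)"
    using ln_le_minus_one[of "2::real"] ln_realpow[of "2::real" 2] by simp
  define u v where "u = real s * (ln P * (M - 2) / 2)" and "v = (M + 2) / 2 * (16 * g + D)"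
  have "real s * (2 + ln 4) \<le> u"
    unfolding u_def using big ln4 by (intro mult_left_mono) auto
  moreover have "4 / 2 * (16 * g + D) \<le> v"
    unfolding v_def using g D M by (intro mult_right_mono) auto
  moreover have AJ: "A4 * (1 - 2 * \<theta>) * J * ln P = 2 * (real s * ln P) + u + v"
    unfolding AJ u_def v_def by (simp add: field_simps)
  ultimately have main: "2 * real s * (ln P + 1) + (D + 49 / 2 * g) + real s * ln 4 - A4 * (1 - 2 * \<theta>) * J * ln P \<le> - D"
    unfolding AJ using g D by (simp add: algebra_simps)
  have pw: "x ^ m = exp (real m * ln x)" if "x > 0" for x :: real and m
    using that by (simp add: exp_of_nat_mult)
  have e1: "(P * exp 1) ^ (2 * s) = exp (2 * real s * (ln P + 1))"
    using P by (subst pw) (auto simp: ln_mult)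
  have e2: "(4::real) ^ s = exp (real s * ln 4)" by (rule pw) simp
  have e3: "P powr (- (A4 * (1 - 2 * \<theta>) * J) - A4 * \<theta>) = exp (- (A4 * (1 - 2 * \<theta>) * J * ln P)) * P powr (- (A4 * \<theta>))"
  proof -
    have "P powr (- (A4 * (1 - 2 * \<theta>) * J)) = exp (- (A4 * (1 - 2 * \<theta>) * J * ln P))"
      using P by (simp add: powr_def)
    then show ?thesis by (simp only: diff_conv_add_uminus powr_add)
  qed
  have e4: "49 / 2 * \<kappa> * real s * ln P / \<psi> = 49 / 2 * g" by (simp add: g_def)
  have "exp (1 / 2) * (P * exp 1) ^ (2 * s) * exp (D + 49 / 2 * \<kappa> * real s * ln P / \<psi>)
      * (4 ^ s * P powr (- (A4 * (1 - 2 * \<theta>) * J) - A4 * \<theta>))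
     = (exp (2 * real s * (ln P + 1)) * exp (D + 49 / 2 * g) * exp (real s * ln 4) * exp (- (A4 * (1 - 2 * \<theta>) * J * ln P)))
       * (exp (1 / 2) * P powr (- (A4 * \<theta>)))"
    unfolding e1 e2 e3 e4 by (simp only: mult_ac)
  also have "exp (2 * real s * (ln P + 1)) * exp (D + 49 / 2 * g) * exp (real s * ln 4) * exp (- (A4 * (1 - 2 * \<theta>) * J * ln P))
     = exp (2 * real s * (ln P + 1) + (D + 49 / 2 * g) + real s * ln 4 - A4 * (1 - 2 * \<theta>) * J * ln P)"
    by (simp only: exp_add[symmetric] diff_conv_add_uminus)
  also have "\<dots> * (exp (1 / 2) * P powr (- (A4 * \<theta>))) \<le> exp (- D) * (exp (1 / 2) * P powr (- (A4 * \<theta>)))"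
    using main by (intro mult_right_mono) auto
  finally show ?thesis .
qed

lemma posterior_empty: "posterior n p X lam pis {} Y = 0"
  by (simp add: posterior_def prior_nn_def)

lemma nn_integral_posterior_event_le:
  fixes pis :: "nat \<Rightarrow> real" and A1 A2 A3 A4 M :: real
  assumes p: "p \<ge> 2" and A: "A1 > 0" "A2 > 0" "A4 > 0" and M: "M > 2"
    and big: "ln (real p) * (M - 2) / 2 \<ge> 4"
    and big2: "8 * A2 \<le> real p powr (A4 * ((M - 2) / (4 * M)))"
    and pis: "\<And>s. s \<le> p \<Longrightarrow> pis s \<ge> 0" "(\<Sum>s\<le>p. pis s) = 1"
    and lam: "lam > 0" "colnorm n p X / real p \<le> lam" "lam \<le> 2 * lambar n p X"
    and ratio: "\<And>s. s \<in> {1..p} \<Longrightarrow> A1 * real p powr (- A3) * pis (s - 1) \<le> pis s"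
      "\<And>s. s \<in> {1..p} \<Longrightarrow> pis s \<le> A2 * real p powr (- A4) * pis (s - 1)"
  shows "(\<integral>\<^sup>+Y. posterior n p X lam pis (event n p X lam A4 M \<beta>0 \<beta>s) Y \<partial>data_measure n p X \<beta>0)
     \<le> ennreal (2 / real p + 2 * sqrt (exp (1 / 2) * real p powr (- (A4 * ((M - 2) / (4 * M))))))"
proof (cases "supp p \<beta>s = {} \<or> compat n p X (supp p \<beta>s) > 0")
  \<comment> \<open>This is the threshold +infinity, where the guard in \<open>event\<close>
    applies.\<close>
  case False
  then have "event n p X lam A4 M \<beta>0 \<beta>s = {}" by (auto simp: event_def)
  then show ?thesis by (simp add: posterior_empty)
next
  case phi: True
  define P where "P = real p"
  have P: "P \<ge> 2" using p by (simp add: P_def)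
  define \<theta> where "\<theta> = (M - 2) / (4 * M)"
  have theta: "0 \<le> \<theta>" "0 \<le> 1 - 2 * \<theta>" using M by (auto simp: \<theta>_def field_simps)
  define \<eta> where "\<eta> = exp (1 / 2) * P powr (- (A4 * \<theta>))"
  have eta: "\<eta> > 0" using P by (simp add: \<eta>_def)
  have lnP: "ln P > 0" using P by simp
  have lb: "lambar n p X > 0" using lam by simp
  have C: "colnorm n p X > 0"
  proof (rule ccontr)
    assume "\<not> ?thesis"
    then have "lambar n p X \<le> 0" unfolding lambar_def using lnP
      by (auto simp: P_def intro!: mult_nonpos_nonneg)
    with lb show False by simp
  qed
  define s where "s = card (supp p \<beta>s)"
  define D where "D = dot n (bias p X \<beta>0 \<beta>s) (bias p X \<beta>0 \<beta>s)"
  have D: "D \<ge> 0" unfolding D_def by (rule dot_self_nonneg)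
  define \<psi> where "\<psi> = (compat n p X (supp p \<beta>s))\<^sup>2"
  define \<kappa> where "\<kappa> = lam / lambar n p X"
  have k: "\<kappa> \<ge> 0" unfolding \<kappa>_def using lam lb by simp
  have psi: "\<psi> \<ge> 0" by (simp add: \<psi>_def)
  define J where "J = M / A4 * (1 + 16 / \<psi> * \<kappa>) * real s + M / A4 * D / ln P"
  have J: "J \<ge> 0" unfolding J_def using M A k psi D lnP by simp
  define a where "a = A2 * P powr (- A4)"
  have a: "a \<ge> 0" unfolding a_def using A by simp
  \<comment> \<open>The exponent A4 per extra coordinate is shared out: one \<open>\<theta>\<close>
    absorbs the constant \<open>8 * A2\<close>, a second one, collected since m \<ge> 1, gives decay
    even when J = 0, and 1 - 2 \<theta> remains to act on J.\<close>
  define b where "b = P powr (- (A4 * (1 - \<theta>)))"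
  define K where "K = P powr (- (A4 * (1 - 2 * \<theta>) * J) - A4 * \<theta>)"
  have pos: "pis s' > 0" if "s' \<le> p" for s'
    by (rule prior_weight_pos[OF pis a _ _ ratio(1) that])
       (use ratio(2) A p in \<open>auto simp: a_def P_def\<close>)
  have "s \<le> p" using card_mono[of "{..<p}" "supp p \<beta>s"] by (auto simp: s_def supp_def)
  then have ps: "pis s > 0" by (rule pos)
  have "8 * a = 8 * A2 * P powr (- A4)" by (simp add: a_def)
  also have "\<dots> \<le> P powr (A4 * \<theta>) * P powr (- A4)"
    using big2 by (intro mult_right_mono) (auto simp: P_def \<theta>_def)
  also have "\<dots> = b" by (simp add: b_def powr_add[symmetric] algebra_simps)
  finally have ab: "4 * a \<le> 1 / 2 * b" by simp
  have bK: "b ^ m \<le> K" if m: "m \<ge> 1" "J < real m" for m :: nat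
  proof -
    have "(1 - 2 * \<theta>) * J + \<theta> * 1 \<le> (1 - 2 * \<theta>) * real m + \<theta> * real m"
      using m theta by (intro add_mono mult_left_mono) auto
    then have "A4 * ((1 - 2 * \<theta>) * J + \<theta>) \<le> A4 * ((1 - \<theta>) * real m)"
      using A by (intro mult_left_mono) (auto simp: algebra_simps)
    then have "P powr (- (A4 * (1 - \<theta>)) * real m) \<le> K"
      unfolding K_def using P by (intro powr_mono) (auto simp: algebra_simps)
    moreover have "b ^ m = b powr real m" using P by (simp add: b_def powr_realpow)
    ultimately show ?thesis by (simp add: b_def powr_powr)
  qed
  have tail: "(\<Sum>s' | s' \<le> p \<and> real s + J < real s'. pis s' * 4 ^ s') \<le> pis s * 4 ^ s * K"
    by (rule sum_prior_tail_le[where pis = pis and a = a and b = b and s = s and J = J,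
          OF less_imp_le[OF ps] a _ ab J bK]) (use ratio(2) in \<open>auto simp: a_def P_def\<close>)
  have B: "real s + J < real (card (supp p \<beta>))" if "\<beta> \<in> event n p X lam A4 M \<beta>0 \<beta>s" for \<beta>
    using that unfolding event_def J_def s_def D_def \<psi>_def \<kappa>_def P_def bias_def l2norm_squared by simp
  let ?R = "49 / 2 * \<kappa> * real s * ln P / \<psi>"
  let ?E = "exp (1 / 2) * (P * exp 1) ^ (2 * s) * exp (D + ?R)"
  \<comment> \<open>The minimiser of c exp D + exp (- D) \<eta> / c; both terms then equal
    \<open>sqrt \<eta>\<close> and D disappears.\<close>
  define c where "c = exp (- D) * sqrt \<eta>"
  have c: "c > 0" using eta by (simp add: c_def)
  have "?E * (\<Sum>s' | s' \<le> p \<and> real s + J < real s'. pis s' * 4 ^ s') / pis s \<le> ?E * (pis s * 4 ^ s * K) / pis s"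
    using tail ps P by (intro divide_right_mono mult_left_mono) auto
  also have "\<dots> = ?E * (4 ^ s * K)" using ps by simp
  also have "\<dots> \<le> exp (- D) * \<eta>"
    unfolding K_def \<eta>_def J_def \<theta>_def using exponent_balance[OF P A(3) M _ D k psi, of s] big
    by (simp only: P_def)
  finally have main: "?E * (\<Sum>s' | s' \<le> p \<and> real s + J < real s'. pis s' * 4 ^ s') / pis s \<le> exp (- D) * \<eta>" .
  have "(\<integral>\<^sup>+Y. posterior n p X lam pis (event n p X lam A4 M \<beta>0 \<beta>s) Y \<partial>data_measure n p X \<beta>0)
    \<le> ennreal (2 / P + c * exp D + 1 / c * (?E * (\<Sum>s' | s' \<le> p \<and> real s + J < real s'. pis s' * 4 ^ s') / pis s))"
    using nn_integral_posterior_le[OF C lam(2) p lam(1,3) phi pos B c, where ?\<beta>0.0 = \<beta>0]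
    unfolding P_def D_def s_def \<kappa>_def \<psi>_def by simp
  also have "\<dots> \<le> ennreal (2 / P + c * exp D + 1 / c * (exp (- D) * \<eta>))"
    using main c by (intro ennreal_leI add_left_mono mult_left_mono) auto
  also have "2 / P + c * exp D + 1 / c * (exp (- D) * \<eta>) = 2 / P + 2 * sqrt \<eta>"
    using eta by (simp add: c_def exp_minus real_div_sqrt)
  finally show ?thesis unfolding \<eta>_def P_def \<theta>_def .
qed

theorem theorem10:
  fixes n p :: "nat \<Rightarrow> nat" and X :: "nat \<Rightarrow> nat \<Rightarrow> nat \<Rightarrow> real"
    and lam :: "nat \<Rightarrow> real" and pis :: "nat \<Rightarrow> nat \<Rightarrow> real"
    and A1 A2 A3 A4 M :: real
  assumes n_lim: "filterlim n at_top sequentially"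
    and p_lim: "filterlim p at_top sequentially"
    and prior_nonneg: "\<And>k s. s \<le> p k \<Longrightarrow> pis k s \<ge> 0"
    and prior_sum: "\<And>k. (\<Sum>s\<le>p k. pis k s) = 1"
    and lam_pos: "\<And>k. lam k > 0"
    and A_pos: "A1 > 0" "A2 > 0" "A3 > 0" "A4 > 0"
    and lam_range: "\<forall>\<^sub>F k in sequentially.
        colnorm (n k) (p k) (X k) / real (p k) \<le> lam k \<and> lam k \<le> 2 * lambar (n k) (p k) (X k)"
    and prior_ratio: "\<forall>\<^sub>F k in sequentially. \<forall>s\<in>{1..p k}.
        A1 * real (p k) powr (- A3) * pis k (s - 1) \<le> pis k s \<and>
        pis k s \<le> A2 * real (p k) powr (- A4) * pis k (s - 1)"
    and M: "M > 2"
  shows "(\<lambda>k. SUP \<beta>0p \<in> (UNIV :: ((nat \<Rightarrow> real) \<times> (nat \<Rightarrow> real)) set).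
            \<integral>\<^sup>+ Y. posterior (n k) (p k) (X k) (lam k) (pis k)
                      (event (n k) (p k) (X k) (lam k) A4 M (fst \<beta>0p) (snd \<beta>0p)) Y
                 \<partial>(data_measure (n k) (p k) (X k) (fst \<beta>0p)))
         \<longlonglongrightarrow> 0"
proof -
  define \<alpha> where "\<alpha> = A4 * ((M - 2) / (4 * M))"
  have alpha: "\<alpha> > 0" using A_pos M by (simp add: \<alpha>_def)
  let ?u = "\<lambda>x::real. 2 / x + 2 * sqrt (exp (1 / 2) * x powr (- \<alpha>))"
  have p_real: "filterlim (\<lambda>k. real (p k)) at_top sequentially"
    using filterlim_compose[OF filterlim_real_sequentially p_lim] .
  have "((\<lambda>x::real. 2 / x) \<longlongrightarrow> 0) at_top" "((\<lambda>x::real. x powr (- \<alpha>)) \<longlongrightarrow> 0) at_top"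
    using alpha by real_asymp+
  then have "(?u \<longlongrightarrow> 0 + 2 * sqrt (exp (1 / 2) * 0)) at_top" by (intro tendsto_intros)
  then have "(?u \<longlongrightarrow> 0) at_top" by simp
  then have "((\<lambda>k. ?u (real (p k))) \<longlongrightarrow> 0) sequentially"
    by (rule filterlim_compose[OF _ p_real])
  then have lim: "(\<lambda>k. ennreal (?u (real (p k)))) \<longlonglongrightarrow> 0"
    using tendsto_ennrealI by fastforce
  have "\<forall>\<^sub>F x in at_top. x \<ge> 2 \<and> ln x * (M - 2) / 2 \<ge> 4 \<and> 8 * A2 \<le> x powr \<alpha>"
  proof (intro eventually_conj)
    show "\<forall>\<^sub>F x in at_top. x \<ge> (2::real)" by (rule eventually_ge_at_top)
    have "filterlim (\<lambda>x::real. ln x * (M - 2) / 2) at_top at_top" using M by real_asymp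
    then show "\<forall>\<^sub>F x in at_top. ln x * (M - 2) / 2 \<ge> 4" unfolding filterlim_at_top by blast
    have "filterlim (\<lambda>x::real. x powr \<alpha>) at_top at_top" using alpha by real_asymp
    then show "\<forall>\<^sub>F x in at_top. 8 * A2 \<le> x powr \<alpha>" unfolding filterlim_at_top by blast
  qed
  then have "\<forall>\<^sub>F k in sequentially. real (p k) \<ge> 2 \<and> ln (real (p k)) * (M - 2) / 2 \<ge> 4 \<and> 8 * A2 \<le> real (p k) powr \<alpha>"
    by (rule eventually_compose_filterlim[OF _ p_real])
  \<comment> \<open>The bound depends on p alone, so it passes through the supremum over both
    vectors.\<close>
  then have bound: "\<forall>\<^sub>F k in sequentially.
     (SUP \<beta>0p \<in> (UNIV :: ((nat \<Rightarrow> real) \<times> (nat \<Rightarrow> real)) set).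
            \<integral>\<^sup>+ Y. posterior (n k) (p k) (X k) (lam k) (pis k)
                      (event (n k) (p k) (X k) (lam k) A4 M (fst \<beta>0p) (snd \<beta>0p)) Y
                 \<partial>(data_measure (n k) (p k) (X k) (fst \<beta>0p))) \<le> ennreal (?u (real (p k)))"
    using lam_range prior_ratio
  proof eventually_elim
    case (elim k)
    show ?case
    proof (rule SUP_least)
      fix \<beta>0p :: "(nat \<Rightarrow> real) \<times> (nat \<Rightarrow> real)"
      show "(\<integral>\<^sup>+ Y. posterior (n k) (p k) (X k) (lam k) (pis k)
                      (event (n k) (p k) (X k) (lam k) A4 M (fst \<beta>0p) (snd \<beta>0p)) Y
                 \<partial>(data_measure (n k) (p k) (X k) (fst \<beta>0p))) \<le> ennreal (?u (real (p k)))"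
        unfolding \<alpha>_def
        by (rule nn_integral_posterior_event_le[where ?A1.0 = A1 and ?A2.0 = A2 and ?A3.0 = A3])
           (use elim A_pos M prior_nonneg prior_sum lam_pos in \<open>auto simp: \<alpha>_def\<close>)
    qed
  qed
  show ?thesis
    by (rule tendsto_sandwich[OF _ bound tendsto_const lim]) simp
qed

end
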